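(* Let $A_1$ be the 3-state Mealy automaton over the 2-symbol alphabet $\{x_0,x_1\}$ whose automatic transformations have the unrolled forms $$f_0=(f_0,f_1)(x_1,x_1),\qquad f_1=(f_0,f_2)(x_1,x_1),\qquad f_2=(f_1,f_1)(x_0,x_0).$$ Then: (1) The semigroup $S_{A_1}$ of automatic transformations generated by $f_0,f_1,f_2$ has the semigroup presentation with generators $f_0,f_1,f_2$ and defining relations $$f_1f_2=f_0f_2,\qquad f_1^2f_i=f_1f_0f_2\ (i=0,1),\qquad f_0^2f_1=f_0^2,$$ $$f_2f_0f_1=f_2^2f_j=f_2f_0^2\ (j=0,1,2),\qquad f_0^4=f_0^3,\qquad f_0^3f_2=f_0^3,$$ $$f_0f_2f_0^2=f_0f_1f_0f_2,\qquad f_1f_0f_2f_0=f_1f_0f_2,\qquad f_2f_0^3=f_2f_0^2 .$$ (2) The growth function $\gamma_{A_1}$ of $A_1$ is a composite function for $k=2$, given by $$\gamma_{A_1}(2n)=23\cdot 2^{n-2}-1,\qquad \gamma_{A_1}(2n+1)=32\cdot 2^{n-2}-1\qquad\text{for all } n\ge 2,$$ and $\gamma_{A_1}(1)=3$, $\gamma_{A_1}(2)=8$, $\gamma_{A_1}(3)=14$.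
   Context: A Mealy automaton with states $q_0,\dots,q_{n-1}$ and input/output alphabet $X_m=\{x_0,\dots,x_{m-1}\}$ has a transition function $\pi:X_m\times Q\to Q$ and an output function $\lambda:X_m\times Q\to X_m$. The state $q_i$ defines an automatic transformation $f_i=f_{q_i}$ of the set of finite (or infinite) words over $X_m$: on input $x u$ ($x$ a letter) it outputs $\lambda(x,q_i)$ followed by $f_{\pi(x,q_i)}(u)$. The unrolled form $f_i=(g_0,\dots,g_{m-1})(y_0,\dots,y_{m-1})$ means $f_i(x_ju)=y_j\,g_j(u)$ for every letter $x_j$ and word $u$. Products of transformations are compositions applied from right to left: $(fg)(u)=f(g(u))$. $S_A$ is the semigroup generated by the automatic transformations $f_0,\dots,f_{n-1}$ under composition. The growth function of $A$ is $\gamma_A(n)=|Q_{A^{(n)}}|$, the number of states of the minimal automaton equivalent to the $n$-th power $A^n$ (sequential application); equivalently, for $n\ge1$, $\gamma_A(n)$ is the number of distinct transformations of the form $f_{i_1}f_{i_2}\cdots f_{i_n}$ (products of exactly $n$ generators). A function $\gamma:\mathbb N\to\mathbb N$ is called composite if there is an integer $k\ge 2$ such that at least two of the functions $n\mapsto\gamma(kn+i)$, $0\le i<k$, can be defined by different expressions; it is then called composite for this $k$.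
   Formalization: The relation f_0^2 f_1 = f_0^2 is false (the two sides differ on the word x_0x_1x_1x_0x_0) and is replaced by f_0^2 f_1 = f_0^3; all other relations and the growth formulas are as printed. *)

theory Defs
  imports Main
begin

section \<open>Mealy automata\<close>

text \<open>The alphabet is the whole type of letters; the set of states is explicit, because the
  automata compared below have different sets of states.\<close>

record ('q, 'x) mealy =
  states :: "'q set"
  trans  :: "'x \<Rightarrow> 'q \<Rightarrow> 'q"
  out    :: "'x \<Rightarrow> 'q \<Rightarrow> 'x"

definition mealy_automaton :: "('q, 'x) mealy \<Rightarrow> bool" where
  "mealy_automaton A \<longleftrightarrow> finite (states A) \<and> states A \<noteq> {} \<and> (\<forall>x. \<forall>q\<in>states A. trans A x q \<in> states A)"

primrec transf :: "('q, 'x) mealy \<Rightarrow> 'q \<Rightarrow> 'x list \<Rightarrow> 'x list" where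
  "transf A q [] = []"
| "transf A q (x # u) = out A x q # transf A (trans A x q) u"

inductive_set automaton_semigroup :: "('q, 'x) mealy \<Rightarrow> ('x list \<Rightarrow> 'x list) set"
  for A :: "('q, 'x) mealy" where
  gen: "q \<in> states A \<Longrightarrow> transf A q \<in> automaton_semigroup A"
| comp: "f \<in> automaton_semigroup A \<Longrightarrow> g \<in> automaton_semigroup A \<Longrightarrow> f \<circ> g \<in> automaton_semigroup A"

section \<open>Powers, minimal automata, growth\<close>

text \<open>A state of the \<open>n\<close>-th power is a list \<open>[q\<^sub>1, \<dots>, q\<^sub>n]\<close>; it reads a letter from
  right to left, so that it defines the product of the transformations of \<open>q\<^sub>1, \<dots>, q\<^sub>n\<close>
  (see \<open>transf_mealy_power\<close>).\<close>

primrec power_out :: "('q, 'x) mealy \<Rightarrow> 'x \<Rightarrow> 'q list \<Rightarrow> 'x" where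
  "power_out A x [] = x"
| "power_out A x (q # qs) = out A (power_out A x qs) q"

primrec power_trans :: "('q, 'x) mealy \<Rightarrow> 'x \<Rightarrow> 'q list \<Rightarrow> 'q list" where
  "power_trans A x [] = []"
| "power_trans A x (q # qs) = trans A (power_out A x qs) q # power_trans A x qs"

definition mealy_power :: "('q, 'x) mealy \<Rightarrow> nat \<Rightarrow> ('q list, 'x) mealy" where
  "mealy_power A n = \<lparr>states = {qs. length qs = n \<and> set qs \<subseteq> states A},
     trans = power_trans A, out = power_out A\<rparr>"

definition mealy_equiv :: "('p, 'x) mealy \<Rightarrow> ('q, 'x) mealy \<Rightarrow> bool" where
  "mealy_equiv A B \<longleftrightarrow> transf A ` states A = transf B ` states B"

text \<open>The number of states of a minimal automaton equivalent to \<open>A\<close>. Every finite automaton has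
  an isomorphic copy with states in \<open>nat\<close>, so it suffices to let those compete.\<close>

definition minimal_size :: "('q, 'x) mealy \<Rightarrow> nat" where
  "minimal_size A = (LEAST k. \<exists>B :: (nat, 'x) mealy.
     mealy_automaton B \<and> mealy_equiv B A \<and> card (states B) = k)"

definition growth :: "('q, 'x) mealy \<Rightarrow> nat \<Rightarrow> nat" where
  "growth A n = minimal_size (mealy_power A n)"

text \<open>``Defined by different expressions'' is read as: different as functions of \<open>n\<close>, where
  finitely many exceptional values of \<open>n\<close> do not count as a difference.\<close>

definition composite_for :: "(nat \<Rightarrow> nat) \<Rightarrow> nat \<Rightarrow> bool" where
  "composite_for \<gamma> k \<longleftrightarrow> k \<ge> 2 \<and>
     (\<exists>i<k. \<exists>j<k. infinite {n. \<gamma> (k * n + i) \<noteq> \<gamma> (k * n + j)})"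

section \<open>Semigroup presentations\<close>

definition free_semigroup :: "'a list set" where
  "free_semigroup = {w. w \<noteq> []}"

text \<open>The congruence on the free semigroup generated by \<open>R\<close>.\<close>

inductive_set congruence_gen :: "('a list \<times> 'a list) set \<Rightarrow> ('a list \<times> 'a list) set"
  for R :: "('a list \<times> 'a list) set" where
  base: "(u, v) \<in> R \<Longrightarrow> (u, v) \<in> congruence_gen R"
| refl: "u \<in> free_semigroup \<Longrightarrow> (u, u) \<in> congruence_gen R"
| sym: "(u, v) \<in> congruence_gen R \<Longrightarrow> (v, u) \<in> congruence_gen R"
| trans: "(u, v) \<in> congruence_gen R \<Longrightarrow> (v, w) \<in> congruence_gen R \<Longrightarrow> (u, w) \<in> congruence_gen R"
| left: "(u, v) \<in> congruence_gen R \<Longrightarrow> w \<in> free_semigroup \<Longrightarrow> (w @ u, w @ v) \<in> congruence_gen R"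
| right: "(u, v) \<in> congruence_gen R \<Longrightarrow> w \<in> free_semigroup \<Longrightarrow> (u @ w, v @ w) \<in> congruence_gen R"

text \<open>The semigroup \<open>S\<close> with product \<open>mult\<close> is presented by the generators \<open>g a\<close> (with \<open>a\<close> ranging
  over all of \<open>'a\<close>) and the relations \<open>R\<close>: it is isomorphic to the quotient of the free
  semigroup by the congruence generated by \<open>R\<close>, generators corresponding to generators.\<close>

definition presented_by ::
  "'s set \<Rightarrow> ('s \<Rightarrow> 's \<Rightarrow> 's) \<Rightarrow> ('a \<Rightarrow> 's) \<Rightarrow> ('a list \<times> 'a list) set \<Rightarrow> bool" where
  "presented_by S mult g R \<longleftrightarrow> R \<subseteq> free_semigroup \<times> free_semigroup \<and>
     (\<exists>\<phi>. bij_betw \<phi> (free_semigroup // congruence_gen R) S \<and>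
       (\<forall>u\<in>free_semigroup. \<forall>v\<in>free_semigroup.
          \<phi> (congruence_gen R `` {u @ v}) =
            mult (\<phi> (congruence_gen R `` {u})) (\<phi> (congruence_gen R `` {v}))) \<and>
       (\<forall>a. \<phi> (congruence_gen R `` {[a]}) = g a))"

section \<open>The automaton and its relations\<close>

datatype letter = X0 | X1
datatype state = F0 | F1 | F2

fun A1_trans :: "letter \<Rightarrow> state \<Rightarrow> state" where
  "A1_trans X0 F0 = F0" | "A1_trans X1 F0 = F1"
| "A1_trans X0 F1 = F0" | "A1_trans X1 F1 = F2"
| "A1_trans X0 F2 = F1" | "A1_trans X1 F2 = F1"

fun A1_out :: "letter \<Rightarrow> state \<Rightarrow> letter" where
  "A1_out x F0 = X1"
| "A1_out x F1 = X1"
| "A1_out x F2 = X0"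

definition A1 :: "(state, letter) mealy" where
  "A1 = \<lparr>states = UNIV, trans = A1_trans, out = A1_out\<rparr>"

text \<open>The source prints the fourth relation below as \<open>f\<^sub>0\<^sup>2 f\<^sub>1 = f\<^sub>0\<^sup>2\<close>. This is a
  misprint, since the two sides are different transformations (\<open>A1_misprint\<close>); the
  relation that holds is \<open>f\<^sub>0\<^sup>2 f\<^sub>1 = f\<^sub>0\<^sup>3\<close>.\<close>

definition A1_relations :: "(state list \<times> state list) set" where
  "A1_relations = {
     ([F1, F2], [F0, F2]),
     ([F1, F1, F0], [F1, F0, F2]),
     ([F1, F1, F1], [F1, F0, F2]),
     ([F0, F0, F1], [F0, F0, F0]),
     ([F2, F0, F1], [F2, F0, F0]),
     ([F2, F2, F0], [F2, F0, F0]),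
     ([F2, F2, F1], [F2, F0, F0]),
     ([F2, F2, F2], [F2, F0, F0]),
     ([F0, F0, F0, F0], [F0, F0, F0]),
     ([F0, F0, F0, F2], [F0, F0, F0]),
     ([F0, F2, F0, F0], [F0, F1, F0, F2]),
     ([F1, F0, F2, F0], [F1, F0, F2]),
     ([F2, F0, F0, F0], [F2, F0, F0])}"

section \<open>Basic facts\<close>

lemma A1_unrolled:
  "transf A1 F0 (X0 # u) = X1 # transf A1 F0 u" "transf A1 F0 (X1 # u) = X1 # transf A1 F1 u"
  "transf A1 F1 (X0 # u) = X1 # transf A1 F0 u" "transf A1 F1 (X1 # u) = X1 # transf A1 F2 u"
  "transf A1 F2 (X0 # u) = X0 # transf A1 F1 u" "transf A1 F2 (X1 # u) = X0 # transf A1 F1 u"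
  by (simp_all add: A1_def)

lemma A1_misprint:
  "transf A1 F0 \<circ> transf A1 F0 \<circ> transf A1 F1 \<noteq> transf A1 F0 \<circ> transf A1 F0"
proof
  assume "transf A1 F0 \<circ> transf A1 F0 \<circ> transf A1 F1 = transf A1 F0 \<circ> transf A1 F0"
  from fun_cong[OF this, of "[X0, X1, X1, X0, X0]"] show False
    by (simp add: A1_def)
qed

lemma transf_mealy_power:
  "transf (mealy_power A n) qs = foldr (\<lambda>q f. transf A q \<circ> f) qs id"
proof
  fix u show "transf (mealy_power A n) qs u = foldr (\<lambda>q f. transf A q \<circ> f) qs id u"
  proof (induction u arbitrary: qs)
    case Nil
    show ?case by (induction qs) auto
  next
    case (Cons x u)
    have "foldr (\<lambda>q f. transf A q \<circ> f) qs id (x # u)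
        = power_out A x qs # foldr (\<lambda>q f. transf A q \<circ> f) (power_trans A x qs) id u"
      by (induction qs) auto
    moreover have "transf (mealy_power A n) qs (x # u)
        = power_out A x qs # transf (mealy_power A n) (power_trans A x qs) u"
      by (simp add: mealy_power_def)
    ultimately show ?case by (simp only: Cons.IH)
  qed
qed

lemma minimal_size_eq_card:
  fixes A :: "('q, 'x) mealy"
  assumes "mealy_automaton A"
  shows "minimal_size A = card (transf A ` states A)"
proof -
  let ?T = "transf A ` states A"
  have fin: "finite ?T" and ne: "?T \<noteq> {}"
    using assms by (auto simp: mealy_automaton_def)
  obtain e :: "('x list \<Rightarrow> 'x list) \<Rightarrow> nat" where inj: "inj_on e ?T"
    using finite_imp_inj_to_nat_seg[OF fin] by blast
  define d where "d = the_inv_into ?T e"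
  have d: "d (e t) = t" if "t \<in> ?T" for t
    unfolding d_def using inj that by (rule the_inv_into_f_f)
  define B :: "(nat, 'x) mealy" where
    "B = \<lparr>states = e ` ?T, trans = (\<lambda>x k. e (\<lambda>u. tl (d k (x # u)))), out = (\<lambda>x k. hd (d k [x]))\<rparr>"
  have step: "(\<lambda>u. tl (transf A q (x # u))) = transf A (trans A x q)" for x q
    by auto
  have closed: "trans A x q \<in> states A" if "q \<in> states A" for x q
    using assms that by (auto simp: mealy_automaton_def)
  have B: "transf B (e (transf A q)) u = transf A q u" if "q \<in> states A" for q u
    using that
  proof (induction u arbitrary: q)
    case (Cons x u)
    have "trans B x (e (transf A q)) = e (transf A (trans A x q))"
      using d Cons.prems step by (simp add: B_def)
    moreover have "out B x (e (transf A q)) = out A x q"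
      using d Cons.prems by (simp add: B_def)
    ultimately show ?case using Cons closed by simp
  qed simp
  have "mealy_automaton B"
    using fin ne d closed by (auto simp: mealy_automaton_def B_def)
  moreover have "mealy_equiv B A"
  proof -
    have "transf B ` states B = (\<lambda>q. transf B (e (transf A q))) ` states A"
      by (simp add: B_def image_image)
    also have "\<dots> = transf A ` states A"
      using B by (intro image_cong) auto
    finally show ?thesis by (simp add: mealy_equiv_def)
  qed
  moreover have "card (states B) = card ?T"
    using card_image[OF inj] by (simp add: B_def)
  moreover have "card ?T \<le> card (states C)"
    if "mealy_automaton C" "mealy_equiv C A" for C :: "(nat, 'x) mealy"
    using that card_image_le[of "states C" "transf C"]
    by (simp add: mealy_automaton_def mealy_equiv_def)
  ultimately show ?thesis
    unfolding minimal_size_def by (intro Least_equality) blast+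
qed

lemma growth_eq_card:
  assumes "mealy_automaton A"
  shows "growth A n = card ((\<lambda>qs. foldr (\<lambda>q f. transf A q \<circ> f) qs id) `
    {qs. length qs = n \<and> set qs \<subseteq> states A})"
proof -
  have "power_trans A x qs \<in> {qs. length qs = n \<and> set qs \<subseteq> states A}"
    if "length qs = n" "set qs \<subseteq> states A" for x qs n
    using that assms by (induction qs arbitrary: n) (auto simp: mealy_automaton_def)
  moreover have "finite {qs. length qs = n \<and> set qs \<subseteq> states A}"
    using assms finite_lists_length_eq[of "states A" n] by (simp add: mealy_automaton_def conj_commute)
  moreover obtain q where "q \<in> states A"
    using assms by (auto simp: mealy_automaton_def)
  then have "{qs. length qs = n \<and> set qs \<subseteq> states A} \<noteq> {}"
    by (auto intro!: exI[of _ "replicate n q"])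
  ultimately have "mealy_automaton (mealy_power A n)"
    unfolding mealy_automaton_def mealy_power_def by simp
  from minimal_size_eq_card[OF this] show ?thesis
    by (simp add: growth_def transf_mealy_power) (simp add: mealy_power_def)
qed

end

theory Submission
  imports Defs
begin

text \<open>The relations form, together with four consequences, a complete rewriting system. Its normal forms
  are, apart from a few short words, of the shape \<open>p c\<^sub>1 \<dots> c\<^sub>k t\<close> with blocks \<open>c\<^sub>i\<close> equal to \<open>f\<^sub>0f\<^sub>2\<close> or
  \<open>f\<^sub>1f\<^sub>0\<close>, a prefix \<open>p\<close> from \<open>{1, f\<^sub>0, f\<^sub>2}\<close> and a short tail \<open>t\<close>. Reading one letter moves the blocks past
  a state \<open>f\<^sub>1\<close> while exchanging the two kinds; reading two letters removes \<open>c\<^sub>1\<close>, shows in the output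
  which block it was, and replaces \<open>t\<close> by \<open>f\<^sub>1\<close> times a section of \<open>f\<^sub>1\<close> times a section of \<open>t\<close>, which again
  begins with a block. Distinct tails lead to different blocks for a suitable input, so distinct
  normal forms define distinct transformations. Only normal forms ending in a left zero
  \<open>f\<^sub>0\<^sup>3\<close>, \<open>f\<^sub>1f\<^sub>0f\<^sub>2\<close> or \<open>f\<^sub>2f\<^sub>0\<^sup>2\<close> are products of more generators than their length, and counting yields the
  growth function.\<close>

section \<open>Words of states acting on inputs\<close>

lemma A1_sel [simp]: "states A1 = UNIV" "trans A1 = A1_trans" "out A1 = A1_out"
  by (simp_all add: A1_def)

definition act :: "state list \<Rightarrow> letter list \<Rightarrow> letter list" where
  "act w = foldr (\<lambda>q f. transf A1 q \<circ> f) w id"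

lemma act_Nil [simp]: "act [] = id"
  by (simp add: act_def)

lemma act_state_Cons: "act (q # w) = transf A1 q \<circ> act w"
  by (simp add: act_def)

lemma act_append: "act (u @ v) = act u \<circ> act v"
  by (induction u) (auto simp: act_state_Cons)

lemma act_empty_word [simp]: "act w [] = []"
  by (induction w) (auto simp: act_state_Cons)

lemma act_letter_Cons: "act w (x # z) = power_out A1 x w # act (power_trans A1 x w) z"
  by (induction w) (auto simp: act_state_Cons)

lemma length_act [simp]: "length (act w z) = length z"
  by (induction z arbitrary: w) (auto simp: act_letter_Cons)

text \<open>Licenses the passage from an equation of transformations to equations of their sections,
  the basic move of the separation arguments.\<close>

lemma act_eq_iff:
  "act u = act v \<longleftrightarrow> (\<forall>x. power_out A1 x u = power_out A1 x v \<and>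
     act (power_trans A1 x u) = act (power_trans A1 x v))"
proof
  assume *: "act u = act v"
  have "act u (x # z) = act v (x # z)" for x z by (simp add: *)
  then show "\<forall>x. power_out A1 x u = power_out A1 x v \<and>
     act (power_trans A1 x u) = act (power_trans A1 x v)"
    unfolding act_letter_Cons by auto
next
  assume *: "\<forall>x. power_out A1 x u = power_out A1 x v \<and>
     act (power_trans A1 x u) = act (power_trans A1 x v)"
  show "act u = act v"
  proof
    fix z show "act u z = act v z"
      using * by (cases z) (simp_all add: act_letter_Cons)
  qed
qed

lemma power_out_append [simp]: "power_out A x (u @ v) = power_out A (power_out A x v) u"
  by (induction u) auto

lemma power_trans_append [simp]:
  "power_trans A x (u @ v) = power_trans A (power_out A x v) u @ power_trans A x v"
  by (induction u) auto

section \<open>Rewriting to normal forms\<close>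

abbreviation cong (infix "\<approx>" 50) where
  "u \<approx> v \<equiv> (u, v) \<in> congruence_gen A1_relations"

lemma A1_relations_nonempty: "(u, v) \<in> A1_relations \<Longrightarrow> u \<noteq> [] \<and> v \<noteq> []"
  by (auto simp: A1_relations_def)

lemma cong_nonempty: "u \<approx> v \<Longrightarrow> u \<noteq> [] \<and> v \<noteq> []"
  by (induction rule: congruence_gen.induct) (auto simp: free_semigroup_def dest: A1_relations_nonempty)

lemma cong_refl: "u \<noteq> [] \<Longrightarrow> u \<approx> u"
  by (simp add: congruence_gen.refl free_semigroup_def)

lemma cong_context: "u \<approx> v \<Longrightarrow> p @ u @ s \<approx> p @ v @ s"
  using congruence_gen.left[of "u @ s" "v @ s" A1_relations p]
    congruence_gen.right[of u v A1_relations s]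
    congruence_gen.left[of u v A1_relations p]
  by (cases "p = []"; cases "s = []") (auto simp: free_semigroup_def)

lemma cong_trans: "u \<approx> v \<Longrightarrow> v \<approx> w \<Longrightarrow> u \<approx> w"
  by (rule congruence_gen.trans)

lemma cong_rel_append: "(u, v) \<in> A1_relations \<Longrightarrow> u @ s \<approx> v @ s"
  using cong_context[OF congruence_gen.base, of u v "[]" s] by simp

lemma cong_absorb:
  assumes "w \<noteq> []" "\<And>q. w @ [q] \<approx> w"
  shows "w @ s \<approx> w"
proof (induction s)
  case Nil
  then show ?case using assms(1) by (simp add: cong_refl)
next
  case (Cons q s)
  have "w @ q # s \<approx> w @ s"
    using cong_context[OF assms(2), of "[]" q s] by simp
  then show ?case using Cons cong_trans by blast
qed

lemma cong_110: "F1 # F1 # F0 # s \<approx> F1 # F0 # F2 # s"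
  and cong_111: "F1 # F1 # F1 # s \<approx> F1 # F0 # F2 # s"
  and cong_001: "F0 # F0 # F1 # s \<approx> F0 # F0 # F0 # s"
  and cong_12: "F1 # F2 # s \<approx> F0 # F2 # s"
  and cong_201: "F2 # F0 # F1 # s \<approx> F2 # F0 # F0 # s"
  and cong_220: "F2 # F2 # F0 # s \<approx> F2 # F0 # F0 # s"
  and cong_221: "F2 # F2 # F1 # s \<approx> F2 # F0 # F0 # s"
  and cong_222: "F2 # F2 # F2 # s \<approx> F2 # F0 # F0 # s"
  and cong_1020: "F1 # F0 # F2 # F0 # s \<approx> F1 # F0 # F2 # s"
  and cong_2000: "F2 # F0 # F0 # F0 # s \<approx> F2 # F0 # F0 # s"
  and cong_0200: "F0 # F2 # F0 # F0 # s \<approx> F0 # F1 # F0 # F2 # s"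
  and cong_0000: "F0 # F0 # F0 # F0 # s \<approx> F0 # F0 # F0 # s"
  and cong_0002: "F0 # F0 # F0 # F2 # s \<approx> F0 # F0 # F0 # s"
  using cong_rel_append[of "[F1, F1, F0]" "[F1, F0, F2]" s]
    cong_rel_append[of "[F1, F1, F1]" "[F1, F0, F2]" s]
    cong_rel_append[of "[F0, F0, F1]" "[F0, F0, F0]" s]
    cong_rel_append[of "[F1, F2]" "[F0, F2]" s]
    cong_rel_append[of "[F2, F0, F1]" "[F2, F0, F0]" s]
    cong_rel_append[of "[F2, F2, F0]" "[F2, F0, F0]" s]
    cong_rel_append[of "[F2, F2, F1]" "[F2, F0, F0]" s]
    cong_rel_append[of "[F2, F2, F2]" "[F2, F0, F0]" s]
    cong_rel_append[of "[F1, F0, F2, F0]" "[F1, F0, F2]" s]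
    cong_rel_append[of "[F2, F0, F0, F0]" "[F2, F0, F0]" s]
    cong_rel_append[of "[F0, F2, F0, F0]" "[F0, F1, F0, F2]" s]
    cong_rel_append[of "[F0, F0, F0, F0]" "[F0, F0, F0]" s]
    cong_rel_append[of "[F0, F0, F0, F2]" "[F0, F0, F0]" s]
  by (simp_all add: A1_relations_def)

lemma absorb_000: "F0 # F0 # F0 # s \<approx> [F0, F0, F0]"
proof -
  have "[F0, F0, F0] @ [q] \<approx> [F0, F0, F0]" for q
  proof (cases q)
    case F1
    have "[F0, F0, F0, F1] \<approx> [F0, F0, F0, F0]"
      using cong_context[OF cong_001[of "[]"], of "[F0]" "[]"] by simp
    then show ?thesis using F1 cong_0000[of "[]"] cong_trans by auto
  qed (use cong_0000[of "[]"] cong_0002[of "[]"] in auto)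
  from cong_absorb[OF _ this, of s] show ?thesis by simp
qed

text \<open>\<open>F1 F1 F1 F0\<close> and \<open>F1 F1 F1 F1\<close> are each evaluated in two
  ways, starting from either end. Comparing the results gives absorption of \<open>F2\<close> and
  then of \<open>F1\<close>; absorption of \<open>F0\<close> is a relation.\<close>

lemma absorb_102: "F1 # F0 # F2 # s \<approx> [F1, F0, F2]"
proof -
  have 2: "[F1, F0, F2, F2] \<approx> [F1, F0, F2]"
  proof -
    have "[F1, F1, F1, F0] \<approx> [F1, F1, F0, F2]"
      using cong_context[OF cong_110[of "[]"], of "[F1]" "[]"] by simp
    then show ?thesis
      using cong_110[of "[F2]"] cong_111[of "[F0]"] cong_1020[of "[]"]
      by (meson cong_trans congruence_gen.sym)
  qed
  have 1: "[F1, F0, F2, F1] \<approx> [F1, F0, F2]"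
  proof -
    have "[F1, F1, F1, F1] \<approx> [F1, F1, F0, F2]"
      using cong_context[OF cong_111[of "[]"], of "[F1]" "[]"] by simp
    then show ?thesis
      using cong_110[of "[F2]"] cong_111[of "[F1]"] 2
      by (meson cong_trans congruence_gen.sym)
  qed
  have "[F1, F0, F2] @ [q] \<approx> [F1, F0, F2]" for q
    using 1 2 cong_1020[of "[]"] by (cases q) auto
  from cong_absorb[OF _ this, of s] show ?thesis by simp
qed

text \<open>\<open>cong_2000\<close> inserts a third \<open>F0\<close>, so that the left zero
  \<open>F0 F0 F0\<close> swallows \<open>s\<close> before the extra letter is removed
  again.\<close>

lemma absorb_200: "F2 # F0 # F0 # s \<approx> [F2, F0, F0]"
proof -
  have 1: "F2 # F0 # F0 # s \<approx> F2 # F0 # F0 # F0 # s"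
    by (meson cong_2000 congruence_gen.sym)
  have 2: "F2 # F0 # F0 # F0 # s \<approx> [F2, F0, F0, F0]"
    using cong_context[OF absorb_000[of s], of "[F2]" "[]"] by simp
  show ?thesis using 1 2 cong_2000[of "[]"] by (meson cong_trans)
qed

text \<open>The equations for \<open>[F2, F0, F0]\<close> in \<open>lmul0\<close> and \<open>[F0, F1, F0, F2]\<close> in \<open>lmul1\<close> come from
  \<open>f\<^sub>0f\<^sub>2f\<^sub>0\<^sup>2 = f\<^sub>0f\<^sub>1f\<^sub>0f\<^sub>2\<close> and its consequence \<open>f\<^sub>1f\<^sub>0f\<^sub>1f\<^sub>0f\<^sub>2 = f\<^sub>1f\<^sub>0f\<^sub>2\<close>. In most of the others
  the product is one of the left zeros \<open>f\<^sub>0\<^sup>3\<close>, \<open>f\<^sub>1f\<^sub>0f\<^sub>2\<close> and \<open>f\<^sub>2f\<^sub>0\<^sup>2\<close>.\<close>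

fun lmul0 :: "state list \<Rightarrow> state list" where
  "lmul0 (F0 # F0 # w) = [F0, F0, F0]"
| "lmul0 (F0 # F1 # w) = [F0, F0, F0]"
| "lmul0 [F2, F0, F0] = [F0, F1, F0, F2]"
| "lmul0 w = F0 # w"

fun lmul1 :: "state list \<Rightarrow> state list" where
  "lmul1 (F2 # w) = lmul0 (F2 # w)"
| "lmul1 (F1 # F0 # w) = [F1, F0, F2]"
| "lmul1 (F1 # F1 # w) = [F1, F0, F2]"
| "lmul1 (F0 # F2 # w) = [F1, F0, F2]"
| "lmul1 [F0, F1, F0, F2] = [F1, F0, F2]"
| "lmul1 w = F1 # w"

fun lmul2 :: "state list \<Rightarrow> state list" where
  "lmul2 (F2 # q # w) = [F2, F0, F0]"
| "lmul2 (F0 # F0 # w) = [F2, F0, F0]"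
| "lmul2 (F0 # F1 # w) = [F2, F0, F0]"
| "lmul2 w = F2 # w"

fun lmul :: "state \<Rightarrow> state list \<Rightarrow> state list" where
  "lmul F0 = lmul0" | "lmul F1 = lmul1" | "lmul F2 = lmul2"

text \<open>Folding from the right end needs only products of a generator with a normal form. That
  different normal forms are not congruent is shown by separating their actions, not by a confluence
  argument.\<close>

definition nf :: "state list \<Rightarrow> state list" where
  "nf w = foldr lmul w []"

lemma nf_simps [simp]: "nf [] = []" "nf (q # w) = lmul q (nf w)"
  by (simp_all add: nf_def)

lemma cong_lmul0: "F0 # w \<approx> lmul0 w"
proof (induction w rule: lmul0.induct)
  case (2 w)
  then show ?case using cong_trans[OF cong_001 absorb_000, of w] by simp
qed (simp_all add: absorb_000 cong_0200[of "[]"] cong_refl)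

lemma cong_lmul1: "F1 # w \<approx> lmul1 w"
proof (induction w rule: lmul1.induct)
  case (1 w)
  then show ?case using cong_trans[OF cong_12 cong_lmul0, of w] by (simp del: lmul0.simps)
next
  case (2 w)
  then show ?case using cong_trans[OF cong_110 absorb_102, of w] by simp
next
  case (3 w)
  then show ?case using cong_trans[OF cong_111 absorb_102, of w] by simp
next
  case 5
  \<comment> \<open>Undoing \<open>cong_0200\<close> behind \<open>F1\<close> exposes the left zero
    \<open>F1 F0 F2\<close>.\<close>
  have "[F1, F0, F1, F0, F2] \<approx> [F1, F0, F2, F0, F0]"
    using cong_context[OF congruence_gen.sym[OF cong_0200[of "[]"]], of "[F1]" "[]"] by simp
  from cong_trans[OF this absorb_102] show ?case by simp
qed (simp_all add: absorb_102 cong_refl)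

lemma cong_lmul2: "F2 # w \<approx> lmul2 w"
proof (induction w rule: lmul2.induct)
  case (1 q w)
  then show ?case
    using cong_trans[OF cong_220 absorb_200, of w] cong_trans[OF cong_221 absorb_200, of w]
      cong_trans[OF cong_222 absorb_200, of w]
    by (cases q) simp_all
next
  case (3 w)
  then show ?case using cong_trans[OF cong_201 absorb_200, of w] by simp
qed (simp_all add: absorb_200 cong_refl)

lemma cong_lmul: "q # w \<approx> lmul q w"
  by (cases q) (simp_all add: cong_lmul0 cong_lmul1 cong_lmul2)

lemma cong_nf: "w \<noteq> [] \<Longrightarrow> w \<approx> nf w"
proof (induction w)
  case (Cons q w)
  show ?case
  proof (cases "w = []")
    case True
    then show ?thesis using cong_lmul[of q "[]"] by simp
  next
    case False
    then have "q # w \<approx> q # nf w"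
      using cong_context[of w "nf w" "[q]" "[]"] Cons by simp
    from cong_trans[OF this cong_lmul] show ?thesis by simp
  qed
qed simp

lemma nf_eq_imp_cong: "u \<noteq> [] \<Longrightarrow> v \<noteq> [] \<Longrightarrow> nf u = nf v \<Longrightarrow> u \<approx> v"
  by (metis cong_nf cong_trans congruence_gen.sym)

text \<open>The two sides of a defining relation have congruent sections, so the relations hold on
  inputs of length \<open>n + 1\<close> once all their consequences hold on inputs of length \<open>n\<close>.\<close>

lemma relation_sections:
  assumes "(u, v) \<in> A1_relations"
  shows "power_out A1 x u = power_out A1 x v \<and> power_trans A1 x u \<approx> power_trans A1 x v"
proof -
  have "power_out A1 x u = power_out A1 x v \<and> nf (power_trans A1 x u) = nf (power_trans A1 x v)
      \<and> power_trans A1 x u \<noteq> [] \<and> power_trans A1 x v \<noteq> []"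
    using assms unfolding A1_relations_def by (cases x) auto
  then show ?thesis using nf_eq_imp_cong by blast
qed

lemma cong_imp_act_eq:
  assumes "u \<approx> v"
  shows "act u = act v"
proof -
  have "u \<approx> v \<Longrightarrow> act u z = act v z" for z u v
  proof (induction "length z" arbitrary: z u v)
    case 0
    then show ?case by simp
  next
    case (Suc n)
    \<comment> \<open>The inner induction runs over the derivation with the input length fixed but
      the input arbitrary: a right factor replaces the input by another one of the same length. Only
      a defining relation consumes a letter.\<close>
    have "length z = Suc n \<Longrightarrow> act u z = act v z" if "u \<approx> v" for z u v
      using that
    proof (induction arbitrary: z rule: congruence_gen.induct)
      case (base u v)
      then obtain x y where z: "z = x # y" by (cases z) auto
      have "act (power_trans A1 x u) y = act (power_trans A1 x v) y"
        using Suc(1)[of y] base z relation_sections[of u v x] by simp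
      then show ?case using relation_sections[OF base(1)] by (simp add: z act_letter_Cons)
    qed (auto simp: act_append)
    then show ?case using Suc(2,3) by metis
  qed
  then show ?thesis using assms by blast
qed

lemma act_nf: "act (nf w) = act w"
  using cong_imp_act_eq[OF cong_nf, of w] by (cases "w = []") auto

section \<open>Separating the normal forms\<close>

definition block :: "bool \<Rightarrow> state list" where
  "block c = (if c then [F0, F2] else [F1, F0])"

abbreviation blocks :: "bool list \<Rightarrow> state list" where
  "blocks C \<equiv> concat (map block C)"

lemma block_simps [simp]: "block True = [F0, F2]" "block False = [F1, F0]"
  by (simp_all add: block_def)

lemma power_out_block [simp]: "power_out A1 x (block c) = X1"
  by (cases c) auto

lemma power_trans_block: "power_trans A1 X1 (block c) = (if c then F0 else F2) # [F1]"
  by (cases c) auto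

lemma power_out_blocks [simp]: "power_out A1 X1 (blocks C) = X1"
  by (induction C) auto

lemma act_12: "act (F1 # F2 # u) = act (F0 # F2 # u)"
  by (rule cong_imp_act_eq) (rule cong_12)

lemma act_Cons_cong: "act u = act v \<Longrightarrow> act (q # u) = act (q # v)"
  by (simp add: act_state_Cons)

lemma act_left_cong: "act u = act v \<Longrightarrow> act (w @ u) = act (w @ v)"
  by (simp add: act_append)

text \<open>Reading \<open>X1\<close> turns \<open>F0 F2\<close> into \<open>F0 F1\<close> and
  \<open>F1 F0\<close> into \<open>F2 F1\<close>. An \<open>F1\<close> in front completes the
  opposite block, by \<open>f1 f2 = f0 f2\<close> in the second case, and the last \<open>F1\<close>
  plays the same part for the next block.\<close>

lemma act_sections_blocks:
  "act (F1 # power_trans A1 X1 (blocks C) @ u) = act (blocks (map Not C) @ F1 # u)"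
proof (induction C)
  case (Cons c C)
  have "act (F1 # power_trans A1 X1 (blocks (c # C)) @ u) =
      act (block (\<not> c) @ F1 # power_trans A1 X1 (blocks C) @ u)"
    by (cases c) (simp_all add: act_12)
  also have "\<dots> = act (block (\<not> c) @ blocks (map Not C) @ F1 # u)"
    using Cons by (rule act_left_cong)
  finally show ?case by simp
qed simp

section \<open>Collisions behind a common context\<close>

definition prefixes :: "state list set" where
  "prefixes = {[], [F0], [F2]}"

text \<open>Equality alone is too rigid for an induction, because a section taken behind a context
  leaves another context in front. With the context left free, the relation survives both the
  removal of a common block and the passage to sections.\<close>

definition collide :: "state list \<Rightarrow> state list \<Rightarrow> bool" where
  "collide u v \<longleftrightarrow> (\<exists>p\<in>prefixes. \<exists>C. act (p @ blocks C @ u) = act (p @ blocks C @ v))"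

text \<open>A prefix reads \<open>X1\<close> and becomes \<open>F1\<close>, which then passes
  through the blocks. Without a prefix, the first block becomes \<open>F0 F1\<close> or
  \<open>F2 F1\<close>, whose first letter is the new prefix. An empty context would provide no
  \<open>F1\<close>.\<close>

lemma act_section_context:
  assumes "p \<in> prefixes" "p \<noteq> [] \<or> C \<noteq> []"
  shows "\<exists>p'\<in>prefixes. \<exists>C'. \<forall>u.
    act (power_trans A1 X1 (p @ blocks C) @ u) = act (p' @ blocks C' @ F1 # u)"
proof (cases "p = []")
  case True
  with assms obtain c C0 where C: "C = c # C0" by (cases C) auto
  have "act (power_trans A1 X1 (p @ blocks C) @ u) =
      act ([if c then F0 else F2] @ blocks (map Not C0) @ F1 # u)" for u
    using act_Cons_cong[OF act_sections_blocks, of _ C0 u] by (simp add: C True power_trans_block)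
  moreover have "[if c then F0 else F2] \<in> prefixes" by (simp add: prefixes_def)
  ultimately show ?thesis by blast
next
  case False
  with assms have "power_trans A1 X1 (p @ blocks C) = F1 # power_trans A1 X1 (blocks C)"
    by (auto simp: prefixes_def)
  then have "act (power_trans A1 X1 (p @ blocks C) @ u) =
      act ([] @ blocks (map Not C) @ F1 # u)" for u
    using act_sections_blocks[of C u] by simp
  moreover have "[] \<in> prefixes" by (simp add: prefixes_def)
  ultimately show ?thesis by blast
qed

lemma collide_sym: "collide u v \<Longrightarrow> collide v u"
  unfolding collide_def by metis

lemma collide_cong: "collide u v \<Longrightarrow> act u = act u' \<Longrightarrow> act v = act v' \<Longrightarrow> collide u' v'"
  unfolding collide_def act_append by metis

lemma act_eq_imp_collide: "act (p @ u) = act (p @ v) \<Longrightarrow> p \<in> prefixes \<Longrightarrow> collide u v"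
  unfolding collide_def by (intro bexI[of _ p] exI[of _ "[]"]) auto

lemma collide_block: "collide (block c @ u) (block c @ v) \<Longrightarrow> collide u v"
proof -
  assume "collide (block c @ u) (block c @ v)"
  then obtain p C where "p \<in> prefixes"
    "act (p @ blocks C @ block c @ u) = act (p @ blocks C @ block c @ v)"
    unfolding collide_def by blast
  then show ?thesis
    unfolding collide_def by (intro bexI[of _ p] exI[of _ "C @ [c]"]) auto
qed

text \<open>Both words write \<open>X1\<close>, so the context reads \<open>X1\<close> in both cases
  and hands on an \<open>F1\<close>. For an empty context this \<open>F1\<close> is simply
  multiplied on.\<close>

lemma collide_section:
  assumes "collide u v" "power_out A1 x u = X1" "power_out A1 x v = X1"
  shows "collide (F1 # power_trans A1 x u) (F1 # power_trans A1 x v)"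
proof -
  obtain p C where p: "p \<in> prefixes" and eq: "act (p @ blocks C @ u) = act (p @ blocks C @ v)"
    using assms(1) unfolding collide_def by blast
  have eq': "act (power_trans A1 X1 (p @ blocks C) @ power_trans A1 x u) =
      act (power_trans A1 X1 (p @ blocks C) @ power_trans A1 x v)"
    using spec[OF iffD1[OF act_eq_iff eq], of x] assms(2,3) by simp
  show ?thesis
  proof (cases "p = [] \<and> C = []")
    case True
    then have "act (power_trans A1 x u) = act (power_trans A1 x v)" using eq' by simp
    from act_Cons_cong[OF this] show ?thesis
      by (intro act_eq_imp_collide[of "[]"]) (auto simp: prefixes_def)
  next
    case False
    then obtain p' C' where "p' \<in> prefixes"
      "\<And>u. act (power_trans A1 X1 (p @ blocks C) @ u) = act (p' @ blocks C' @ F1 # u)"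
      using act_section_context[OF p, of C] by blast
    then show ?thesis using eq' unfolding collide_def by (intro bexI[of _ p'] exI[of _ C']) auto
  qed
qed

text \<open>Whatever letter reaches the block, the section of \<open>F0 F2\<close> begins with
  \<open>F0\<close> and that of \<open>F1 F0\<close> with \<open>F2\<close>; behind
  \<open>F1\<close> this gives \<open>F1 F0\<close> and \<open>F1 F2\<close>, the latter acting like
  \<open>F0 F2\<close>.\<close>

lemma act_section_block: "\<exists>u'. act (F1 # power_trans A1 x (block c @ u)) = act (block (\<not> c) @ u')"
  by (cases c) (auto simp: act_12)

lemma act_section_block2:
  "\<exists>u'. act (F1 # power_trans A1 y (F1 # power_trans A1 x (block c @ u))) = act (block c @ u')"
proof -
  obtain u' where "act (F1 # power_trans A1 x (block c @ u)) = act (block (\<not> c) @ u')"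
    using act_section_block by blast
  then have "act (F1 # power_trans A1 y (F1 # power_trans A1 x (block c @ u))) =
      act (F1 # power_trans A1 y (block (\<not> c) @ u'))"
    using act_eq_iff act_Cons_cong by blast
  then show ?thesis using act_section_block[of y "\<not> c" u'] by simp
qed

lemma act_section_blocks_block:
  "\<exists>u'. act (F1 # power_trans A1 X1 (blocks C @ block d @ u)) =
     act (blocks (map Not C) @ block (\<not> d) @ u')"
proof -
  obtain u' where "act (F1 # power_trans A1 X1 (block d @ u)) = act (block (\<not> d) @ u')"
    using act_section_block by blast
  moreover have "act (F1 # power_trans A1 X1 (blocks C @ block d @ u)) =
      act (blocks (map Not C) @ F1 # power_trans A1 X1 (block d @ u))"
    using act_sections_blocks[of C "power_trans A1 X1 (block d @ u)"] by simp
  ultimately show ?thesis using act_left_cong by metis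
qed

text \<open>The first \<open>X1\<close> turns the leading block into \<open>F0 F1\<close> or
  \<open>F2 F1\<close>; at the second, \<open>F0\<close> writes \<open>X1\<close> and
  \<open>F2\<close> writes \<open>X0\<close>, and both become \<open>F1\<close>. All other blocks
  are exchanged twice and so return.\<close>

lemma act_block_two_letters:
  "\<exists>u'. \<forall>z. act (block c @ blocks C @ block d @ u) (X1 # X1 # z) =
     X1 # (if c then X1 else X0) # act (blocks C @ block d @ u') z"
proof -
  let ?q = "if c then F0 else F2"
  obtain u1 where u1: "act (F1 # power_trans A1 X1 (blocks C @ block d @ u)) =
      act (blocks (map Not C) @ block (\<not> d) @ u1)"
    using act_section_blocks_block by blast
  obtain u2 where u2: "act (F1 # power_trans A1 X1 (blocks (map Not C) @ block (\<not> d) @ u1)) =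
      act (blocks C @ block d @ u2)"
    using act_section_blocks_block[of "map Not C" "\<not> d" u1] by (auto simp: comp_def)
  have "act (block c @ blocks C @ block d @ u) (X1 # X1 # z) =
     X1 # (if c then X1 else X0) # act (blocks C @ block d @ u2) z" for z
  proof -
    have "act (block c @ blocks C @ block d @ u) (X1 # X1 # z) =
      X1 # act (?q # F1 # power_trans A1 X1 (blocks C @ block d @ u)) (X1 # z)"
      by (simp add: act_letter_Cons[of "block c @ _"] power_trans_block)
    also have "\<dots> = X1 # act (?q # blocks (map Not C) @ block (\<not> d) @ u1) (X1 # z)"
      using act_Cons_cong[OF u1] by metis
    also have "\<dots> = X1 # (if c then X1 else X0) #
        act (F1 # power_trans A1 X1 (blocks (map Not C) @ block (\<not> d) @ u1)) z"
      by (simp add: act_letter_Cons del: map_map)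
    finally show ?thesis by (simp only: u2)
  qed
  then show ?thesis by blast
qed

text \<open>Each \<open>X1 X1\<close> strips one common block from both words, until the differing
  blocks lead; there the second output letter on \<open>X0 X0\<close> tells them apart.\<close>

lemma act_blocks_clash: "act (blocks C @ block True @ u) \<noteq> act (blocks C @ block False @ v)"
proof (induction C arbitrary: u v)
  case Nil
  have "act (block True @ u) [X0, X0] \<noteq> act (block False @ v) [X0, X0]"
    by (cases "power_out A1 X0 v") (simp_all add: act_letter_Cons)
  then show ?case by auto
next
  case (Cons c C)
  obtain u' v' where
    "\<And>z. act (block c @ blocks C @ block True @ u) (X1 # X1 # z) =
      X1 # (if c then X1 else X0) # act (blocks C @ block True @ u') z"
    "\<And>z. act (block c @ blocks C @ block False @ v) (X1 # X1 # z) =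
      X1 # (if c then X1 else X0) # act (blocks C @ block False @ v') z"
    using act_block_two_letters[of c C True u] act_block_two_letters[of c C False v] by blast
  moreover obtain z where "act (blocks C @ block True @ u') z \<noteq> act (blocks C @ block False @ v') z"
    using Cons by blast
  ultimately have "act (block c @ blocks C @ block True @ u) (X1 # X1 # z) \<noteq>
      act (block c @ blocks C @ block False @ v) (X1 # X1 # z)"
    by simp
  then show ?case by auto
qed

lemma not_collide_TF: "\<not> collide (block True @ u) (block False @ v)"
proof
  assume "collide (block True @ u) (block False @ v)"
  then obtain p C where p: "p \<in> prefixes"
    and eq: "act (p @ blocks C @ block True @ u) = act (p @ blocks C @ block False @ v)"
    unfolding collide_def by blast
  show False
  proof (cases "p = []")
    case True
    then show False using eq act_blocks_clash[of C u v] by simp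
  next
    case False
    \<comment> \<open>One letter \<open>X1\<close> turns the prefix into \<open>F1\<close>, which
      negates all flags; this reduces to the case without prefix with the two words
      interchanged.\<close>
    have pt: "power_trans A1 X1 (p @ w) = F1 # power_trans A1 X1 w"
      if "power_out A1 X1 w = X1" for w
      using p False that by (auto simp: prefixes_def)
    have "act (power_trans A1 X1 (p @ blocks C @ block True @ u)) =
        act (power_trans A1 X1 (p @ blocks C @ block False @ v))"
      using eq act_eq_iff by blast
    then have "act (F1 # power_trans A1 X1 (blocks C @ block True @ u)) =
        act (F1 # power_trans A1 X1 (blocks C @ block False @ v))"
      using pt[of "blocks C @ block True @ u"] pt[of "blocks C @ block False @ v"]
      by (simp del: block_simps power_trans_append)
    moreover obtain u' v' where
      "act (F1 # power_trans A1 X1 (blocks C @ block True @ u)) =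
        act (blocks (map Not C) @ block False @ u')"
      "act (F1 # power_trans A1 X1 (blocks C @ block False @ v)) =
        act (blocks (map Not C) @ block True @ v')"
      using act_section_blocks_block[of C True u] act_section_blocks_block[of C False v]
      by (auto simp del: map_map block_simps)
    ultimately show False
      using act_blocks_clash[of "map Not C" v' u'] by argo
  qed
qed

lemma collide_block_eq: "collide (block c @ u) (block d @ v) \<Longrightarrow> c = d"
  using not_collide_TF[of u v] not_collide_TF[of v u] collide_sym[of "block c @ u" "block d @ v"]
  by (cases c; cases d; simp del: block_simps)

section \<open>Sections along two letters\<close>

lemma nf_eq_imp_act_eq: "nf u = nf v \<Longrightarrow> act u = act v"
  by (metis act_nf)

text \<open>One section exchanges the two kinds of blocks, a second one restores them. Each
  \<open>F1\<close> is the one that \<open>collide_section\<close> puts in front.\<close>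

definition sect2 :: "letter \<Rightarrow> letter \<Rightarrow> state list \<Rightarrow> state list" where
  "sect2 x y u = F1 # power_trans A1 y (F1 # power_trans A1 x u)"

text \<open>\<open>F0 F2\<close> has the section \<open>F0 F1\<close> on either letter, but
  \<open>F1 F0\<close> has \<open>F2 F1\<close> only if \<open>X1\<close> reaches it; on
  \<open>X0\<close> it has \<open>F2 F0\<close>.\<close>

lemma act_section_block_append:
  assumes "c \<or> power_out A1 x w = X1"
  shows "act (F1 # power_trans A1 x (block c @ w)) = act (block (\<not> c) @ F1 # power_trans A1 x w)"
  using assms by (cases c; cases "power_out A1 x w") (simp_all add: act_12)

lemma act_sect2_block_append:
  assumes "c \<or> power_out A1 x w = X1"
  shows "act (sect2 x y (block c @ w)) = act (block c @ sect2 x y w)"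
proof -
  have "act (sect2 x y (block c @ w)) =
      act (F1 # power_trans A1 y (block (\<not> c) @ F1 # power_trans A1 x w))"
    unfolding sect2_def using act_section_block_append[OF assms] act_eq_iff act_Cons_cong by blast
  also have "\<dots> = act (block c @ sect2 x y w)"
    using act_section_block_append[of "\<not> c" y "F1 # power_trans A1 x w"]
    by (simp add: sect2_def)
  finally show ?thesis .
qed

lemma act_sect2_block: "\<exists>u'. act (sect2 x y (block c @ u)) = act (block c @ u')"
  unfolding sect2_def by (rule act_section_block2)

text \<open>The inner \<open>F1\<close> of \<open>sect2\<close> becomes \<open>F0\<close> or
  \<open>F2\<close>, according to the letter it reads, and forms a block with the outer
  \<open>F1\<close>.\<close>

lemma act_sect2: "\<exists>d w'. act (sect2 x y w) = act (block d @ w')"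
proof (cases "power_out A1 y (power_trans A1 x w)")
  case X0
  then have "sect2 x y w = block False @ power_trans A1 y (power_trans A1 x w)"
    by (simp add: sect2_def)
  then show ?thesis by metis
next
  case X1
  then have "act (sect2 x y w) = act (block True @ power_trans A1 y (power_trans A1 x w))"
    by (simp add: sect2_def act_12)
  then show ?thesis by blast
qed

text \<open>The main separation tool: input letters on which two words emit different blocks refute
  a collision, and equal blocks pass the question on to what follows them.\<close>

lemma collide_sect2:
  assumes "collide u v" "power_out A1 x u = X1" "power_out A1 x v = X1"
    and "act (sect2 x y u) = act (block c @ u')" "act (sect2 x y v) = act (block d @ v')"
  shows "c = d \<and> collide u' v'"
proof -
  have "collide (sect2 x y u) (sect2 x y v)"
    unfolding sect2_def using assms(1-3) by (intro collide_section) auto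
  then have "collide (block c @ u') (block d @ v')"
    using assms(4,5) by (rule collide_cong)
  then show ?thesis using collide_block_eq collide_block by blast
qed

lemma collide_sect2_nf:
  assumes "collide u v" "power_out A1 x u = X1" "power_out A1 x v = X1"
    and "nf (sect2 x y u) = nf (block c @ u')" "nf (sect2 x y v) = nf (block d @ v')"
  shows "c = d \<and> collide u' v'"
  using collide_sect2[OF assms(1-3) assms(4,5)[THEN nf_eq_imp_act_eq]] .

lemma collide_block_sect2:
  assumes "collide u (block d @ v)" "power_out A1 x u = X1" "nf (sect2 x y u) = nf (block c @ u')"
  shows "c = d \<and> (\<exists>v'. collide u' v' \<and> act (sect2 x y (block d @ v)) = act (block d @ v'))"
  using collide_sect2[OF assms(1,2) _ nf_eq_imp_act_eq[OF assms(3)]] act_sect2_block[of x y d v]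
  by (metis power_out_append power_out_block)

text \<open>The block emitted by \<open>F1\<close> depends on the input, while
  \<open>block c @ u\<close> always emits \<open>block c\<close>.\<close>

lemma not_collide_F1_block: "\<not> collide [F1] (block c @ u)"
  using collide_block_sect2[of "[F1]" c u X0 X0 True "[F0]"]
    collide_block_sect2[of "[F1]" c u X1 X0 False "[F1]"]
  by (auto simp: sect2_def)

lemma not_collide_Nil_block: "\<not> collide [] (block c @ u)"
  using collide_block_sect2[of "[]" c u X1 X0 False "[]"]
    collide_block_sect2[of "[]" c u X1 X1 True "[]"]
  by (auto simp: sect2_def)

text \<open>The input \<open>X0 X0\<close> forces \<open>c\<close>. On \<open>X0 X1\<close>,
  \<open>F0\<close> then leaves \<open>F1\<close> behind its block, and the other side leaves a
  further block, which \<open>F1\<close> cannot match.\<close>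

lemma not_collide_F0_block: "\<not> collide [F0] (block c @ u)"
proof
  assume *: "collide [F0] (block c @ u)"
  then have c: "c" using collide_block_sect2[OF *, of X0 X0 True "[F0]"] by (simp add: sect2_def)
  have "act (sect2 X0 X1 (block c @ u)) = act (block c @ sect2 X0 X1 u)"
    using c by (intro act_sect2_block_append) simp
  moreover obtain d w where "act (sect2 X0 X1 u) = act (block d @ w)"
    using act_sect2 by blast
  ultimately have "act (sect2 X0 X1 (block c @ u)) = act (block c @ block d @ w)"
    using act_left_cong by metis
  moreover have "act (sect2 X0 X1 [F0]) = act (block True @ [F1])"
    by (rule nf_eq_imp_act_eq) (simp add: sect2_def)
  ultimately have "collide [F1] (block d @ w)"
    using collide_sect2[OF *, of X0 X1 True "[F1]" c "block d @ w"] by simp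
  then show False using not_collide_F1_block by blast
qed

lemma act_sect2_True: "\<exists>d w. act (sect2 x y (block True @ u)) = act (block True @ block d @ w)"
proof -
  obtain d w where "act (sect2 x y u) = act (block d @ w)"
    using act_sect2 by blast
  then show ?thesis
    using act_sect2_block_append[of True x u y] act_left_cong by metis
qed

text \<open>\<open>F2\<close> writes \<open>X0\<close>, which bars \<open>collide_section\<close>;
  the block \<open>F0 F2\<close> kept in front writes \<open>X1\<close>. On \<open>X0 X0\<close> the
  tail \<open>F2\<close> turns into \<open>F0 F2 F0\<close>, which leads back to \<open>F0\<close>
  against a block.\<close>

lemma not_collide_F2_block: "\<not> collide (block True @ [F2]) (block True @ block c @ u)"
proof
  assume *: "collide (block True @ [F2]) (block True @ block c @ u)"
  have F2: "act (sect2 X0 X0 (block True @ [F2])) = act (block True @ block True @ [F0])"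
    by (rule nf_eq_imp_act_eq) (simp add: sect2_def)
  obtain u' where "act (sect2 X0 X0 (block c @ u)) = act (block c @ u')"
      and u': "c \<Longrightarrow> \<exists>d w. u' = block d @ w"
    using act_sect2_True[of X0 X0 u] act_sect2_block[of X0 X0 c u] by (cases c) metis+
  then have "act (sect2 X0 X0 (block True @ block c @ u)) = act (block True @ block c @ u')"
    using act_sect2_block_append[of True X0 "block c @ u" X0] act_left_cong by metis
  then have **: "collide (block True @ [F0]) (block c @ u')"
    using collide_sect2[OF * _ _ F2, of True "block c @ u'"] by simp
  then have c using collide_block_eq by metis
  then have "collide [F0] u'" using ** collide_block by metis
  then show False using u' \<open>c\<close> not_collide_F0_block by blast
qed

section \<open>Separating tails from tails and from cores\<close>

definition trues :: "nat \<Rightarrow> state list" where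
  "trues j = blocks (replicate j True)"

lemma trues_simps [simp]: "trues 0 = []" "trues (Suc j) = block True @ trues j"
  by (simp_all add: trues_def)

lemma trues_True [simp]: "trues j @ F0 # F2 # w = F0 # F2 # trues j @ w"
  by (induction j) auto

lemma act_sect2_trues: "act (sect2 x y (trues j @ w)) = act (trues j @ sect2 x y w)"
proof (induction j)
  case (Suc j)
  have "act (sect2 x y (block True @ trues j @ w)) = act (block True @ sect2 x y (trues j @ w))"
    by (rule act_sect2_block_append) simp
  then show ?case using act_left_cong[OF Suc] by (metis append_assoc trues_simps(2))
qed simp

text \<open>\<open>f\<^sub>0\<^sup>2\<close> reproduces itself behind an emitted block \<open>f\<^sub>0f\<^sub>2\<close>, whatever the input.\<close>

lemma act_sect2_00: "act (sect2 x y [F0, F0]) = act (block True @ [F0, F0])"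
  by (rule nf_eq_imp_act_eq) (cases x; cases y; simp add: sect2_def)

text \<open>Each round uses up one block \<open>F0 F2\<close> on the right and leaves
  \<open>[F0, F0]\<close> as it was, so the rest of the right word eventually comes to the
  front.\<close>

lemma collide_00_trues:
  assumes "collide [F0, F0] (trues (Suc j) @ w)" "act (sect2 x y w) = act w'"
  shows "collide [F0, F0] (trues j @ w')"
proof -
  have "act (sect2 x y (trues (Suc j) @ w)) = act (block True @ trues j @ w')"
    using act_sect2_trues[of x y "Suc j" w] act_left_cong[OF assms(2), of "trues (Suc j)"] by simp
  then show ?thesis
    using collide_sect2[OF assms(1) _ _ act_sect2_00[of x y], of True "trues j @ w'"] by simp
qed

lemma not_collide_00_trues_False: "\<not> collide [F0, F0] (trues j @ block False @ u)"
proof (induction j arbitrary: u)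
  case 0
  show ?case
    using collide_block_sect2[of "[F0, F0]" False u X0 X0 True "[F0, F0]"]
    by (auto simp: sect2_def)
next
  case (Suc j)
  show ?case
    using collide_00_trues[of j "block False @ u" X0 X0] act_sect2_block[of X0 X0 False u] Suc
    by metis
qed

lemma not_collide_00_trues_tail:
  assumes "t \<in> {[], [F0], [F1], [F2], [F1, F1]}"
  shows "\<not> collide [F0, F0] (trues (Suc j) @ t)"
proof -
  have step: "\<not> collide [F0, F0] (trues (Suc j) @ t)"
    if "nf (sect2 x y t) = nf w" "\<not> collide [F0, F0] (trues j @ w)" for t x y w
    using that collide_00_trues nf_eq_imp_act_eq by blast
  \<comment> \<open>\<open>F1\<close> can be made to emit \<open>F1 F0\<close>. \<open>F0\<close> is
    led to \<open>F1\<close>, and \<open>F2\<close> to \<open>F0\<close>; the block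
    \<open>F0 F2\<close> emitted on the way restores the number of blocks.\<close>
  have 1: "\<not> collide [F0, F0] (trues (Suc j) @ [F1])"
    using step[of X1 X0 "[F1]" "block False @ [F1]"] not_collide_00_trues_False
    by (simp add: sect2_def)
  then have 0: "\<not> collide [F0, F0] (trues (Suc j) @ [F0])"
    using step[of X0 X1 "[F0]" "block True @ [F1]"]
    by (simp add: sect2_def)
  then have 2: "\<not> collide [F0, F0] (trues (Suc j) @ [F2])"
    using step[of X0 X0 "[F2]" "block True @ [F0]"]
    by (simp add: sect2_def)
  have 3: "\<not> collide [F0, F0] (trues (Suc j) @ [])"
    using step[of X1 X0 "[]" "block False @ []"] not_collide_00_trues_False[of j "[]"]
    by (simp add: sect2_def)
  have 4: "\<not> collide [F0, F0] (trues (Suc j) @ [F1, F1])"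
    using step[of X1 X0 "[F1, F1]" "block False @ [F1, F1]"]
      not_collide_00_trues_False[of j "[F1, F1]"]
    by (simp add: sect2_def)
  show ?thesis using assms 0 1 2 3 4 by blast
qed

text \<open>\<open>core n w\<close> says that \<open>w\<close> is a normal form beginning with a block, and that it is the
  normal form of a word of length \<open>n\<close>. Only words ending in one of the left zeros
  \<open>f\<^sub>1f\<^sub>0f\<^sub>2\<close>, \<open>f\<^sub>0\<^sup>3\<close> and \<open>f\<^sub>2f\<^sub>0\<^sup>2\<close> are normal forms of longer words.\<close>

inductive core :: "nat \<Rightarrow> state list \<Rightarrow> bool" where
  core_True_tail: "t \<in> {[], [F0], [F1], [F2], [F1, F1]} \<Longrightarrow> core (2 + length t) (F0 # F2 # t)"
| core_False_tail: "t \<in> {[], [F0], [F1], [F1, F1]} \<Longrightarrow> core (2 + length t) (F1 # F0 # t)"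
| core_102: "3 \<le> n \<Longrightarrow> core n [F1, F0, F2]"
| core_1000: "4 \<le> n \<Longrightarrow> core n [F1, F0, F0, F0]"
| core_True: "core n w \<Longrightarrow> core (n + 2) (F0 # F2 # w)"
| core_False: "core n w \<Longrightarrow> w \<noteq> [F1, F0, F2] \<Longrightarrow> core (n + 2) (F1 # F0 # w)"

lemma core_block: "core n w \<Longrightarrow> \<exists>c u. w = block c @ u"
  by (erule core.cases) (metis append_Cons append_Nil block_simps)+

text \<open>Leading blocks \<open>F0 F2\<close> of \<open>w\<close> are moved into
  \<open>trues j\<close> until a block \<open>F1 F0\<close> or a tail appears, hence the arbitrary
  \<open>j\<close>.\<close>

lemma not_collide_00_core: "core n w \<Longrightarrow> \<not> collide [F0, F0] (trues j @ w)"
proof (induction arbitrary: j rule: core.induct)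
  case (core_True_tail t)
  then show ?case using not_collide_00_trues_tail[of t j] by simp
next
  case (core_False_tail t)
  then show ?case using not_collide_00_trues_False[of j t] by simp
next
  case core_102
  then show ?case using not_collide_00_trues_False[of j "[F2]"] by simp
next
  case core_1000
  then show ?case using not_collide_00_trues_False[of j "[F0, F0]"] by simp
next
  case (core_True n w)
  then show ?case using core_True(2)[of "Suc j"] by simp
next
  case (core_False n w)
  then show ?case using not_collide_00_trues_False[of j w] by simp
qed

definition tails :: "state list set" where
  "tails = {[], [F0], [F1], [F0, F0], [F1, F1]}"

lemma not_collide_tails:
  assumes "s \<in> tails" "t \<in> tails" "s \<noteq> t"
  shows "\<not> collide s t"
proof -
  have sep: "\<not> collide s t" if "power_out A1 x s = X1" "power_out A1 x t = X1"
    "nf (sect2 x y s) = nf (block c @ s')" "nf (sect2 x y t) = nf (block (\<not> c) @ t')"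
    for s t x y c s' t'
    using collide_sect2_nf[of s t x y c s' "\<not> c" t'] that by auto
  have "\<not> collide [] [F0]"
    by (rule sep[of X1 _ _ X0 False "[]" "[F0]"]) (simp_all add: sect2_def)
  moreover have "\<not> collide [] [F1]"
    by (rule sep[of X1 _ _ X1 True "[]" "[F1]"]) (simp_all add: sect2_def)
  moreover have "\<not> collide [] [F0, F0]"
    by (rule sep[of X1 _ _ X0 False "[]" "[F0, F0]"]) (simp_all add: sect2_def)
  moreover have "\<not> collide [] [F1, F1]"
    by (rule sep[of X1 _ _ X1 True "[]" "[F1, F1]"]) (simp_all add: sect2_def)
  moreover have "\<not> collide [F1] [F0]"
    by (rule sep[of X1 _ _ X0 False "[F1]" "[F0]"]) (simp_all add: sect2_def)
  moreover have 1: "\<not> collide [F1] [F0, F0]"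
    by (rule sep[of X1 _ _ X0 False "[F1]" "[F0, F0]"]) (simp_all add: sect2_def)
  moreover have "\<not> collide [F1] [F1, F1]"
    by (rule sep[of X0 _ _ X0 True "[F0]" "[F1, F0]"]) (simp_all add: sect2_def)
  moreover have "\<not> collide [F0] [F1, F1]"
    by (rule sep[of X0 _ _ X0 True "[F0]" "[F1, F0]"]) (simp_all add: sect2_def)
  moreover have "\<not> collide [F0, F0] [F1, F1]"
    by (rule sep[of X0 _ _ X0 True "[F0, F0]" "[F1, F0]"]) (simp_all add: sect2_def)
  \<comment> \<open>Both tails emit \<open>F0 F2\<close> on every input, so the pair is first led to
    \<open>[F1]\<close> and \<open>[F0, F0]\<close>.\<close>
  moreover have "\<not> collide [F0] [F0, F0]"
    using collide_sect2_nf[of "[F0]" "[F0, F0]" X0 X1 True "[F1]" True "[F0, F0]"] 1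
    by (auto simp: sect2_def)
  ultimately show ?thesis
    using assms collide_sym unfolding tails_def by blast
qed

lemma not_collide_F2_tails:
  assumes "t \<in> {[], [F0], [F1], [F1, F1]}"
  shows "\<not> collide (block True @ [F2]) (block True @ t)"
proof -
  have "\<not> collide (block True @ [F2]) (block True @ [])"
  proof
    assume "collide (block True @ [F2]) (block True @ [])"
    then have "collide (block True @ [F0]) (block False @ [])"
      using collide_sect2_nf[of _ _ X1 X0 True "block True @ [F0]" True "block False @ []"]
      by (simp add: sect2_def)
    then show False using collide_block_eq by blast
  qed
  moreover have 1: "\<not> collide (block True @ [F2]) (block True @ [F1])"
  proof
    assume "collide (block True @ [F2]) (block True @ [F1])"
    then have "collide (block True @ [F0]) (block False @ [F1])"
      using collide_sect2_nf[of _ _ X1 X0 True "block True @ [F0]" True "block False @ [F1]"]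
      by (simp add: sect2_def)
    then show False using collide_block_eq by blast
  qed
  moreover have "\<not> collide (block True @ [F2]) (block True @ [F0])"
    using 1 collide_sect2_nf[of "block True @ [F2]" "block True @ [F0]"
      X0 X1 True "block True @ [F2]" True "block True @ [F1]"]
    by (auto simp add: sect2_def)
  moreover have "\<not> collide (block True @ [F2]) (block True @ [F1, F1])"
  proof
    assume "collide (block True @ [F2]) (block True @ [F1, F1])"
    then have "collide (block True @ [F0]) (block False @ [F1, F0])"
      using collide_sect2_nf[of _ _ X0 X0 True "block True @ [F0]" True "block False @ [F1, F0]"]
      by (simp add: sect2_def)
    then show False using collide_block_eq by blast
  qed
  ultimately show ?thesis using assms by blast
qed

text \<open>\<open>f\<^sub>1f\<^sub>0f\<^sub>2\<close> reproduces itself behind an emitted block \<open>f\<^sub>1f\<^sub>0\<close>, whatever the input.\<close>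

lemma act_sect2_102: "act (sect2 x y [F1, F0, F2]) = act (block False @ [F1, F0, F2])"
  by (rule nf_eq_imp_act_eq) (cases x; cases y; simp add: sect2_def)

lemma not_collide_False_102: "\<not> collide (block False @ []) [F1, F0, F2]"
proof
  assume "collide (block False @ []) [F1, F0, F2]"
  then have "collide (block True @ []) (block False @ [F2])"
    using collide_sect2[OF _ _ _ _ act_sect2_102[of X1 X1],
      of "block False @ []" False "block True @ []"] nf_eq_imp_act_eq
    by (simp add: sect2_def)
  then show False using collide_block_eq by blast
qed

lemma not_collide_11_True: "\<not> collide [F1, F1] (block True @ u)"
  using collide_block_sect2[of "[F1, F1]" True u X0 X0 False "[F1, F0]"]
  by (auto simp: sect2_def)

text \<open>On \<open>X0 X0\<close>, \<open>F1 F1\<close> emits \<open>F1 F0\<close> and leaves a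
  second \<open>F1 F0\<close>, which must then collide with what \<open>w\<close> leaves.\<close>

lemma not_collide_11_False:
  assumes "power_out A1 X0 w = X1" "act (sect2 X0 X0 w) = act w'"
    "\<not> collide (block False @ []) w'"
  shows "\<not> collide [F1, F1] (block False @ w)"
proof
  assume *: "collide [F1, F1] (block False @ w)"
  have "act (sect2 X0 X0 (block False @ w)) = act (block False @ w')"
    using act_sect2_block_append[of False X0 w X0] act_left_cong[OF assms(2), of "block False"]
      assms(1) by simp
  moreover have "act (sect2 X0 X0 [F1, F1]) = act (block False @ block False @ [])"
    by (rule nf_eq_imp_act_eq) (simp add: sect2_def)
  ultimately have "collide (block False @ []) w'"
    using collide_sect2[OF *, of X0 X0 False "block False @ []" False w'] by simp
  then show False using assms(3) by simp
qed

lemma not_collide_11_False_True: "\<not> collide [F1, F1] (block False @ block True @ u)"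
proof -
  obtain u' where "act (sect2 X0 X0 (block True @ u)) = act (block True @ u')"
    using act_sect2_block by blast
  moreover have "\<not> collide (block False @ []) (block True @ u')"
    using collide_block_eq by blast
  ultimately show ?thesis by (intro not_collide_11_False) auto
qed

lemma not_collide_11_False_False:
  assumes "power_out A1 X0 u = X1"
  shows "\<not> collide [F1, F1] (block False @ block False @ u)"
proof -
  obtain d w where "act (sect2 X0 X0 u) = act (block d @ w)"
    using act_sect2 by blast
  then have "act (sect2 X0 X0 (block False @ u)) = act (block False @ block d @ w)"
    using act_sect2_block_append[of False X0 u X0] assms act_left_cong by metis
  moreover have "\<not> collide (block False @ []) (block False @ block d @ w)"
    using collide_block not_collide_Nil_block by blast
  ultimately show ?thesis by (intro not_collide_11_False) auto
qed

lemma not_collide_11_core: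
  assumes w: "core n w"
  shows "\<not> collide [F1, F1] w"
proof -
  \<comment> \<open>On \<open>X1 X1\<close> both emit \<open>F1 F0\<close>; \<open>F1 F1\<close>
    stays, while \<open>F1 F0\<close> leaves \<open>F0 F2\<close>.\<close>
  have Nil: "\<not> collide [F1, F1] (block False @ [])"
    using collide_sect2_nf[of "[F1, F1]" "block False @ []" X1 X1 False "[F1, F1]" False "block True @ []"]
      not_collide_11_True[of "[]"] by (auto simp: sect2_def)
  have neq: "\<not> collide (block False @ []) (block True @ u)" for u
    using collide_block_eq by blast
  have tail: "\<not> collide [F1, F1] (block False @ t)"
    if "nf (sect2 X0 X0 t) = nf (block True @ u)" "power_out A1 X0 t = X1" for t u
    using that not_collide_11_False neq nf_eq_imp_act_eq by blast
  have tail0: "\<not> collide [F1, F1] (block False @ [F0])"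
    by (rule tail[of _ "[F0]"]) (simp_all add: sect2_def)
  have tail1: "\<not> collide [F1, F1] (block False @ [F1])"
    by (rule tail[of _ "[F0]"]) (simp_all add: sect2_def)
  have tail00: "\<not> collide [F1, F1] (block False @ [F0, F0])"
    by (rule tail[of _ "[F0, F0]"]) (simp_all add: sect2_def)
  have 102: "\<not> collide [F1, F1] [F1, F0, F2]"
  proof
    assume *: "collide [F1, F1] [F1, F0, F2]"
    have "act (sect2 X0 X0 [F1, F1]) = act (block False @ block False @ [])"
      by (rule nf_eq_imp_act_eq) (simp add: sect2_def)
    then have "collide (block False @ []) [F1, F0, F2]"
      using collide_sect2[OF * _ _ _ act_sect2_102[of X0 X0], of False "block False @ []"] by simp
    then show False using not_collide_False_102 by blast
  qed
  have 11: "\<not> collide [F1, F1] (block False @ [F1, F1])"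
  proof (rule not_collide_11_False)
    show "act (sect2 X0 X0 [F1, F1]) = act (block False @ block False @ [])"
      by (rule nf_eq_imp_act_eq) (simp add: sect2_def)
    show "\<not> collide (block False @ []) (block False @ block False @ [])"
      using collide_block not_collide_Nil_block by blast
  qed simp
  have FF: "\<not> collide [F1, F1] (block False @ block False @ [])"
  proof (rule not_collide_11_False)
    show "act (sect2 X0 X0 (block False @ [])) = act (block False @ block False @ [])"
      by (rule nf_eq_imp_act_eq) (simp add: sect2_def)
    show "\<not> collide (block False @ []) (block False @ block False @ [])"
      using collide_block not_collide_Nil_block by blast
  qed simp
  have core: "\<not> collide [F1, F1] (block False @ w)" if "core n w" "w \<noteq> [F1, F0, F2]" for n w
    using that
  proof cases
    case (core_True_tail t)
    then show ?thesis using not_collide_11_False_True[of t] by simp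
  next
    case (core_False_tail t)
    then show ?thesis using not_collide_11_False_False[of t] FF by auto
  next
    case core_1000
    then show ?thesis using not_collide_11_False_False[of "[F0, F0]"] by simp
  next
    case (core_True m v)
    then show ?thesis using not_collide_11_False_True[of v] by simp
  next
    case (core_False m v)
    obtain c u where "v = block c @ u" using core_False core_block by blast
    then have "power_out A1 X0 v = X1" by simp
    from not_collide_11_False_False[OF this] show ?thesis by (simp add: core_False(2))
  qed simp
  show "\<not> collide [F1, F1] w"
    using w
  proof cases
    case (core_True_tail t)
    then show ?thesis using not_collide_11_True[of t] by simp
  next
    case (core_False_tail t)
    then show ?thesis using tail0 tail1 Nil 11 by auto
  next
    case core_102
    then show ?thesis using 102 by simp
  next
    case core_1000
    then show ?thesis using tail00 by simp
  next
    case (core_True n w)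
    then show ?thesis using not_collide_11_True[of w] by simp
  next
    case (core_False n w)
    then show ?thesis using core[of n w] by simp
  qed
qed

lemma not_collide_tails_core:
  assumes "t \<in> tails" "core n w"
  shows "\<not> collide t w"
proof -
  obtain c u where "w = block c @ u" using assms(2) core_block by blast
  then show ?thesis
    using assms not_collide_Nil_block not_collide_F0_block not_collide_F1_block
      not_collide_00_core[of n w 0] not_collide_11_core
    unfolding tails_def by auto
qed

lemma core_cases:
  assumes "core n w"
  obtains (True) t where "w = block True @ t"
      "t \<in> {[], [F0], [F1], [F2], [F1, F1]} \<or> (\<exists>m. core m t)"
  | (False) t where "w = block False @ t" "t \<in> tails \<or> (\<exists>m. core m t) \<and> t \<noteq> [F1, F0, F2]"
  | (102) "w = [F1, F0, F2]"
  using assms by cases (auto simp: tails_def)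

text \<open>Induction on the total length: a collision forces equal leading blocks, and these are
  removed. Special care is taken of the tail \<open>F2\<close>, compared with its block still in
  front, and of \<open>F1 F0 F2\<close>.\<close>

lemma core_collide_imp_eq:
  "core m v \<Longrightarrow> core n w \<Longrightarrow> collide v w \<Longrightarrow> v = w"
proof (induction "length v + length w" arbitrary: m n v w rule: less_induct)
  case less
  have absorb: False
    if "block False @ s \<in> {v, w}" "s \<in> tails \<or> (\<exists>m. core m s) \<and> s \<noteq> [F1, F0, F2]"
      "[F1, F0, F2] \<in> {v, w}" "block False @ s \<noteq> [F1, F0, F2]" for s
  proof -
    note s = that(2)
    have "collide (block False @ s) [F1, F0, F2]"
      using that less(4) collide_sym by fastforce
    \<comment> \<open>As a transformation \<open>F1 F0 F2\<close> absorbs a block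
      \<open>F1 F0\<close> in front, which can thus be cancelled against that of the other word.
      Only \<open>s\<close> gets shorter, and this suffices for the measure.\<close>
    moreover have "act [F1, F0, F2] = act (block False @ [F1, F0, F2])"
      by (rule nf_eq_imp_act_eq) simp
    ultimately have "collide (block False @ s) (block False @ [F1, F0, F2])"
      using collide_cong by blast
    then have *: "collide s [F1, F0, F2]" by (rule collide_block)
    have c: "core 3 [F1, F0, F2]" by (rule core.core_102) simp
    show False
    proof (cases "s \<in> tails")
      case True
      then show False using not_collide_tails_core[OF True c] * by blast
    next
      case False
      then obtain k where k: "core k s" "s \<noteq> [F1, F0, F2]" using s by blast
      have "length s + 3 < length v + length w"
        using that(1,3,4) by auto
      then show False using less(1)[of s "[F1, F0, F2]", OF _ k(1) c *] k(2) by simp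
    qed
  qed
  have IH: "s = t" if "core i s" "core k t" "collide s t" "v = block c @ s" "w = block c @ t" for i k s t c
    using less(1)[OF _ that(1-3)] that(4,5) by (cases c) simp_all
  have True_True: "s = t"
    if v: "v = block True @ s" "s \<in> {[], [F0], [F1], [F2], [F1, F1]} \<or> (\<exists>m. core m s)"
      and w: "w = block True @ t" "t \<in> {[], [F0], [F1], [F2], [F1, F1]} \<or> (\<exists>m. core m t)"
    for s t
  proof (rule ccontr)
    assume neq: "s \<noteq> t"
    have c: "collide (block True @ s) (block True @ t)" "collide (block True @ t) (block True @ s)"
      using less(4) v(1) w(1) collide_sym by blast+
    then have c': "collide s t" "collide t s" using collide_block by blast+
    have F2: "u \<in> {[], [F0], [F1], [F1, F1]} \<or> (\<exists>m. core m u) \<Longrightarrow>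
        \<not> collide (block True @ [F2]) (block True @ u)" for u
      using not_collide_F2_tails not_collide_F2_block core_block by metis
    have "s \<noteq> [F2]" "t \<noteq> [F2]"
      using F2[of t] F2[of s] c v(2) w(2) neq by auto
    then have "s \<in> tails \<or> (\<exists>m. core m s)" "t \<in> tails \<or> (\<exists>m. core m t)"
      using v(2) w(2) by (auto simp: tails_def)
    then show False
      using c' neq not_collide_tails not_collide_tails_core IH[OF _ _ _ v(1) w(1)] by metis
  qed
  have False_False: "s = t"
    if v: "v = block False @ s" "s \<in> tails \<or> (\<exists>m. core m s)"
      and w: "w = block False @ t" "t \<in> tails \<or> (\<exists>m. core m t)"
    for s t
  proof (rule ccontr)
    assume neq: "s \<noteq> t"
    have "collide s t" using less(4) v(1) w(1) collide_block by blast
    moreover have "collide t s" using calculation by (rule collide_sym)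
    ultimately show False
      using neq v(2) w(2) not_collide_tails not_collide_tails_core IH[OF _ _ _ v(1) w(1)] by metis
  qed
  have neq: "c = d" if "v = block c @ s" "w = block d @ t" for c d s t
    using less(4) that collide_block_eq by blast
  have b2: "[F1, F0, F2] = block False @ [F2]" by simp
  from less(2) show ?case
  proof (cases rule: core_cases)
    case v: (True s)
    from less(3) show ?thesis
    proof (cases rule: core_cases)
      case (True t)
      then show ?thesis using True_True v by blast
    next
      case (False t)
      then show ?thesis using neq v by blast
    next
      case 102
      then show ?thesis using neq v b2 by blast
    qed
  next
    case v: (False s)
    from less(3) show ?thesis
    proof (cases rule: core_cases)
      case (True t)
      then show ?thesis using neq v by blast
    next
      case (False t)
      then show ?thesis using False_False v by blast
    next
      case 102
      then show ?thesis using absorb[of s] v 102 by (cases "v = w") simp_all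
    qed
  next
    case v: 102
    from less(3) show ?thesis
    proof (cases rule: core_cases)
      case (True t)
      then show ?thesis using neq v b2 by blast
    next
      case (False t)
      then show ?thesis using absorb[of t] v False by (cases "v = w") simp_all
    next
      case 102
      then show ?thesis using v by blast
    qed
  qed
qed

section \<open>Normal forms and the numbers of generators that reach them\<close>

definition short_words :: "state list set" where
  "short_words = {[F0], [F1], [F2], [F0, F0], [F0, F1], [F1, F1], [F2, F0], [F2, F1], [F2, F2],
     [F0, F1, F1], [F2, F1, F1]}"

text \<open>The short words, \<open>F0 F0 F0\<close> and \<open>F2 F0 F0\<close> are together the
  nonempty products of a prefix and a tail, and \<open>F2 F2\<close>. The two left zeros stand apart
  because they are reached for every \<open>n\<close> from 3 on.\<close>

inductive normal_form :: "nat \<Rightarrow> state list \<Rightarrow> bool" where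
  normal_form_short: "w \<in> short_words \<Longrightarrow> normal_form (length w) w"
| normal_form_zero: "3 \<le> n \<Longrightarrow> w \<in> {[F0, F0, F0], [F2, F0, F0]} \<Longrightarrow> normal_form n w"
| normal_form_core: "core n w \<Longrightarrow> normal_form n w"
| normal_form_F0: "core n w \<Longrightarrow> normal_form (Suc n) (F0 # w)"
| normal_form_F2: "core n w \<Longrightarrow> normal_form (Suc n) (F2 # w)"

lemma core_ge_2: "core n w \<Longrightarrow> 2 \<le> n"
  by (induction rule: core.induct) auto

lemma core_short:
  assumes "w \<in> {[F0, F2], [F0, F2, F0], [F0, F2, F1], [F0, F2, F2], [F0, F2, F1, F1],
     [F1, F0], [F1, F0, F0], [F1, F0, F1], [F1, F0, F1, F1]}"
  shows "core (length w) w"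
  using assms core_True_tail[of "tl (tl w)"] core_False_tail[of "tl (tl w)"] by auto

lemma normal_form_lmul_short:
  assumes "w \<in> short_words"
  shows "normal_form (Suc (length w)) (lmul q w)"
proof -
  have short: "normal_form n w" if "length w = n" "w \<in> short_words" for n w
    using that normal_form_short by blast
  have core: "normal_form n w" if "length w = n"
    "w \<in> {[F0, F2], [F0, F2, F0], [F0, F2, F1], [F0, F2, F2], [F0, F2, F1, F1],
     [F1, F0], [F1, F0, F0], [F1, F0, F1], [F1, F0, F1, F1]}" for n w
    using that core_short normal_form_core by blast
  have zero: "normal_form (Suc (Suc (Suc n))) [F0, F0, F0]" "normal_form (Suc (Suc (Suc n))) [F2, F0, F0]"
      "normal_form (Suc (Suc (Suc n))) [F1, F0, F2]" for n
    using normal_form_core[OF core_102, of "Suc (Suc (Suc n))"]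
    by (auto intro: normal_form.intros)
  consider "w = [F0]" | "w = [F1]" | "w = [F2]" | "w = [F0, F0]" | "w = [F0, F1]" | "w = [F1, F1]"
    | "w = [F2, F0]" | "w = [F2, F1]" | "w = [F2, F2]" | "w = [F0, F1, F1]" | "w = [F2, F1, F1]"
    using assms unfolding short_words_def by blast
  then show ?thesis
    by cases (cases q; simp add: short zero core short_words_def)+
qed

lemma lmul_core:
  assumes "core n w"
  shows "lmul F0 w = F0 # w" "lmul F1 w = [F1, F0, F2]" "lmul F2 w = F2 # w"
    "lmul F0 (F0 # w) = [F0, F0, F0]" "lmul F2 (F0 # w) = [F2, F0, F0]"
    "lmul F1 (F0 # w) = (if w = [F1, F0, F2] then [F1, F0, F2] else F1 # F0 # w)"
    "lmul F0 (F2 # w) = F0 # F2 # w" "lmul F1 (F2 # w) = F0 # F2 # w"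
    "lmul F2 (F2 # w) = [F2, F0, F0]"
proof -
  obtain c u where w: "w = block c @ u"
    using assms core_block by blast
  have "lmul1 (F0 # F1 # F0 # u) = (if u = [F2] then [F1, F0, F2] else F1 # F0 # F1 # F0 # u)"
    \<comment> \<open>This rule splits \<open>u\<close> into empty, one-element and longer lists, as
      the patterns of \<open>lmul1\<close> require.\<close>
    by (cases u rule: remdups_adj.cases; cases "hd u") auto
  with w show "lmul F1 (F0 # w) = (if w = [F1, F0, F2] then [F1, F0, F2] else F1 # F0 # w)"
    by (cases c) auto
qed (use core_block[OF assms] in \<open>auto simp: block_def split: if_splits\<close>)

lemma normal_form_lmul:
  assumes "normal_form n w"
  shows "normal_form (Suc n) (lmul q w)"
proof -
  have zero: "normal_form k [F0, F0, F0]" "normal_form k [F2, F0, F0]" "normal_form k [F1, F0, F2]"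
    if "3 \<le> k" for k
    using that by (auto intro: normal_form.intros core_102)
  show ?thesis
    using assms
  proof cases
    case normal_form_short
    then show ?thesis using normal_form_lmul_short by simp
  next
    case normal_form_zero
    have "normal_form (Suc n) [F1, F0, F0, F0]"
      using normal_form_zero by (intro normal_form_core core_1000) simp
    moreover have "normal_form (Suc n) [F0, F1, F0, F2]"
      using normal_form_zero by (intro normal_form_F0 core_102) simp
    ultimately show ?thesis
      using normal_form_zero by (cases q) (auto simp: zero)
  next
    case normal_form_core
    then show ?thesis
      using core_ge_2[of n w]
      by (cases q) (simp_all add: lmul_core[simplified] zero normal_form_F0 normal_form_F2)
  next
    case (normal_form_F0 m v)
    then have "normal_form (Suc n) (lmul F1 w)"
      using core_ge_2[of m v] normal_form_core[OF core_False, of m v]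
      by (simp add: lmul_core[simplified] zero)
    then show ?thesis
      using normal_form_F0 core_ge_2[of m v]
      by (cases q) (simp_all add: lmul_core[simplified] zero)
  next
    case (normal_form_F2 m v)
    have "normal_form (Suc n) (F0 # F2 # v)"
      using normal_form_F2 normal_form_core[OF core_True, of m v] by simp
    then show ?thesis
      using normal_form_F2 core_ge_2[of m v]
      by (cases q) (simp_all add: lmul_core[simplified] zero)
  qed
qed

lemma normal_form_nf: "w \<noteq> [] \<Longrightarrow> normal_form (length w) (nf w)"
proof (induction w)
  case (Cons q w)
  show ?case
  proof (cases "w = []")
    case True
    then show ?thesis
      using normal_form_short[of "[q]"] by (cases q) (auto simp: short_words_def)
  qed (use Cons normal_form_lmul in auto)
qed simp

lemma nf_replicate_F0: "nf (replicate k F0) = replicate (min k 3) F0"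
proof (induction k)
  case (Suc k)
  consider "k = 0" | "k = 1" | "k = 2" | "3 \<le> k" by linarith
  then show ?case using Suc by cases (auto simp: numeral_eq_Suc)
qed simp

lemma core_reached: "core n w \<Longrightarrow> \<exists>v. length v = n \<and> nf v = w"
proof (induction rule: core.induct)
  case (core_True_tail t)
  then show ?case by (intro exI[of _ "F0 # F2 # t"]) auto
next
  case (core_False_tail t)
  then show ?case by (intro exI[of _ "F1 # F0 # t"]) auto
next
  case (core_102 n)
  \<comment> \<open>The left zero \<open>F1 F0 F2\<close> is padded with \<open>F0\<close>s to
    length \<open>n\<close>; the padding has only four possible normal forms.\<close>
  have "replicate (min k 3) F0 \<in> {[], [F0], [F0, F0], [F0, F0, F0]}" for k :: nat
    by (auto simp: min_def numeral_eq_Suc le_Suc_eq)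
  then have "nf (replicate (n - 3) F0) \<in> {[], [F0], [F0, F0], [F0, F0, F0]}"
    using nf_replicate_F0 by metis
  then show ?case
    using core_102 by (intro exI[of _ "F1 # F0 # F2 # replicate (n - 3) F0"]) auto
next
  case (core_1000 n)
  then show ?case
    by (intro exI[of _ "F1 # replicate (n - 1) F0"])
      (simp add: nf_replicate_F0 min_absorb2, simp add: numeral_eq_Suc)
next
  case (core_True n w)
  then show ?case using lmul_core[of n w] by (metis add_2_eq_Suc' length_Cons nf_simps(2))
next
  case (core_False n w)
  then show ?case using lmul_core[of n w] by (metis add_2_eq_Suc' length_Cons nf_simps(2))
qed

lemma normal_form_reached: "normal_form n w \<Longrightarrow> \<exists>v. length v = n \<and> nf v = w"
proof (induction rule: normal_form.cases)
  case (normal_form_short w)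
  then show ?case by (intro exI[of _ w]) (auto simp: short_words_def)
next
  case (normal_form_zero n w)
  have 0: "length (replicate n F0) = n \<and> nf (replicate n F0) = [F0, F0, F0]"
    using normal_form_zero by (simp add: nf_replicate_F0 min_absorb2) (simp add: numeral_eq_Suc)
  have "length (F2 # replicate (n - 1) F0) = n \<and> nf (F2 # replicate (n - 1) F0) = [F2, F0, F0]"
    using normal_form_zero
    by (cases "n = 3") (simp_all add: nf_replicate_F0 min_absorb2, simp_all add: numeral_eq_Suc)
  with 0 show ?case using normal_form_zero by blast
next
  case (normal_form_core n w)
  then show ?case using core_reached by simp
next
  case (normal_form_F0 n w)
  then show ?case using core_reached lmul_core[of n w] by (metis length_Cons nf_simps(2))
next
  case (normal_form_F2 n w)
  then show ?case using core_reached lmul_core[of n w] by (metis length_Cons nf_simps(2))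
qed

lemma nf_image: "0 < n \<Longrightarrow> nf ` {w. length w = n} = {w. normal_form n w}"
  using normal_form_nf normal_form_reached by (fastforce simp: image_iff)

section \<open>Injectivity of the action on normal forms\<close>

definition small_words :: "state list set" where
  "small_words = short_words \<union> {[F0, F0, F0], [F2, F0, F0]}"

lemma act_inj_small_words: "inj_on act small_words"
proof -
  let ?s = "\<lambda>w. (act w [X0, X1, X0, X1, X1, X0, X0], act w [X1, X0, X0, X1, X1, X0, X0])"
  have "inj_on ?s small_words"
    unfolding small_words_def short_words_def inj_on_def
    by (simp add: act_letter_Cons)
  then show ?thesis by (auto simp: inj_on_def)
qed

lemma normal_form_cases:
  assumes "normal_form n w"
  obtains (small) "w \<in> small_words"
  | (core) p u m where "p \<in> prefixes" "core m u" "w = p @ u"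
  using assms
proof cases
  case normal_form_short
  then show ?thesis using small by (simp add: small_words_def)
next
  case normal_form_zero
  then show ?thesis using small by (auto simp: small_words_def)
next
  case normal_form_core
  then show ?thesis using core[of "[]"] by (simp add: prefixes_def)
next
  case (normal_form_F0 m u)
  then show ?thesis using core[of "[F0]"] by (simp add: prefixes_def)
next
  case (normal_form_F2 m u)
  then show ?thesis using core[of "[F2]"] by (simp add: prefixes_def)
qed


lemma act_20_core: "core n w \<Longrightarrow> act (F2 # F0 # w) = act [F2, F0, F0]"
proof -
  assume "core n w"
  then obtain c u where w: "w = block c @ u" using core_block by blast
  show ?thesis
    using cong_imp_act_eq[OF absorb_200, of "F2 # u"]
      cong_imp_act_eq[OF cong_trans[OF cong_201 absorb_200], of "F0 # u"]
    by (cases c) (simp_all add: w)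
qed

lemma act_prefix_tails_core:
  assumes "p \<in> prefixes" "t \<in> tails" "core n w"
  shows "act (p @ t) \<noteq> act (p @ w)"
  using assms not_collide_tails_core act_eq_imp_collide by blast

text \<open>Multiplying by \<open>F2\<close> on the left makes the first word the left zero
  \<open>F2 F0 F0\<close>, and \<open>[F0, F0]\<close> does not collide with a core word.\<close>

lemma act_F0_core_neq:
  assumes "core m v" "core n w"
  shows "act (F0 # v) \<noteq> act w"
proof
  assume "act (F0 # v) = act w"
  then have "act (F2 # F0 # v) = act (F2 # w)" by (rule act_Cons_cong)
  then have "act ([F2] @ [F0, F0]) = act ([F2] @ w)"
    using act_20_core[OF assms(1)] by simp
  then show False
    using act_prefix_tails_core[of "[F2]" "[F0, F0]" n w] assms(2) by (simp add: prefixes_def tails_def)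
qed

lemma act_F2_neq: "power_out A1 X0 w = X1 \<Longrightarrow> act (F2 # v) \<noteq> act w"
proof
  assume "power_out A1 X0 w = X1" "act (F2 # v) = act w"
  then show False using act_eq_iff[of "F2 # v" w]
    by (metis A1_out.simps(3) A1_sel(3) letter.distinct(1) power_out.simps(2))
qed

lemma act_core_inj:
  assumes "p \<in> prefixes" "q \<in> prefixes" "core m v" "core n w" "act (p @ v) = act (q @ w)"
  shows "p @ v = q @ w"
proof -
  have out: "power_out A1 X0 w = X1" if "core n w" for n w
    using core_block[OF that] by auto
  have "p = q"
    using assms act_F0_core_neq[of m v n w] act_F0_core_neq[of n w m v]
      act_F2_neq[of "q @ w" v] act_F2_neq[of "p @ v" w] out
    by (auto simp: prefixes_def)
  then have "collide v w" using assms act_eq_imp_collide by blast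
  then show ?thesis using core_collide_imp_eq assms(3,4) \<open>p = q\<close> by blast
qed

text \<open>One statement for each prefix: apart from words settled by their first output letter and
  products of that prefix with a tail, only a few exceptions remain.\<close>

lemma small_words_cases:
  assumes "s \<in> small_words"
  shows "hd s = F2 \<or> s \<in> tails \<or> s = [F0, F1] \<or> s \<in> {[F0, F0, F0], [F0, F1, F1]}"
    "hd s = F2 \<or> s \<in> (@) [F0] ` tails \<or> s \<in> {[F1], [F1, F1]}"
    "power_out A1 X0 s = X1 \<or> s \<in> (@) [F2] ` tails \<or> s = [F2, F2]"
proof -
  consider "s = [F0]" | "s = [F1]" | "s = [F2]" | "s = [F0, F0]"
    | "s = [F0, F1]" | "s = [F1, F1]" | "s = [F2, F0]" | "s = [F2, F1]"
    | "s = [F2, F2]" | "s = [F0, F1, F1]" | "s = [F2, F1, F1]" | "s = [F0, F0, F0]"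
    | "s = [F2, F0, F0]"
    using assms unfolding small_words_def short_words_def by blast
  then have "(hd s = F2 \<or> s \<in> tails \<or> s = [F0, F1] \<or> s \<in> {[F0, F0, F0], [F0, F1, F1]}) \<and>
    (hd s = F2 \<or> s \<in> (@) [F0] ` tails \<or> s \<in> {[F1], [F1, F1]}) \<and>
    (power_out A1 X0 s = X1 \<or> s \<in> (@) [F2] ` tails \<or> s = [F2, F2])"
    by cases (simp_all add: tails_def)
  then show "hd s = F2 \<or> s \<in> tails \<or> s = [F0, F1] \<or> s \<in> {[F0, F0, F0], [F0, F1, F1]}"
    "hd s = F2 \<or> s \<in> (@) [F0] ` tails \<or> s \<in> {[F1], [F1, F1]}"
    "power_out A1 X0 s = X1 \<or> s \<in> (@) [F2] ` tails \<or> s = [F2, F2]"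
    by blast+
qed

lemma act_small_core_neq:
  assumes s: "s \<in> small_words" and p: "p \<in> prefixes" and w: "core n w"
  shows "act s \<noteq> act (p @ w)"
proof
  assume eq: "act s = act (p @ w)"
  have out: "power_out A1 X0 w = X1"
    using core_block[OF w] by auto
  have left: "act (u @ s) = act (u @ p @ w)" for u
    by (rule act_left_cong) (rule eq)
  have tail: "s \<notin> (@) p ` tails"
    using act_prefix_tails_core[OF p _ w] eq by blast
  have ne: "s \<noteq> []" using s by (auto simp: small_words_def short_words_def)
  have 200: "act (F2 # s) \<noteq> act [F2, F0, F0]" if "s \<in> {[F1], [F1, F1]}"
    using that inj_onD[OF act_inj_small_words, of "F2 # s" "[F2, F0, F0]"]
    by (auto simp: small_words_def short_words_def)
  from p consider "p = []" | "p = [F0]" | "p = [F2]" by (auto simp: prefixes_def)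
  then show False
  proof cases
    case 1
    have "hd s \<noteq> F2"
      using act_F2_neq[OF out, of "tl s"] eq ne 1 by (cases s) auto
    moreover have "hd s = F2 \<or> s \<in> tails \<or> s = [F0, F1] \<or> s \<in> {[F0, F0, F0], [F0, F1, F1]}"
      using small_words_cases(1)[OF s] .
    \<comment> \<open>Multiplying the exceptions on the left by \<open>F0\<close> or
      \<open>F2\<close> yields that generator times \<open>F0 F0\<close>, a prefix times a
      tail.\<close>
    ultimately consider "s = [F0, F1]" | "s \<in> {[F0, F0, F0], [F0, F1, F1]}"
      using tail 1 by auto
    then show False
    proof cases
      case a: 1
      have "act [F0, F0, F1] = act [F0, F0, F0]" by (rule nf_eq_imp_act_eq) simp
      then have "act ([F0] @ [F0, F0]) = act ([F0] @ w)"
        using left[of "[F0]"] a 1 by simp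
      then show False
        using act_prefix_tails_core[of "[F0]" "[F0, F0]" n w] w by (simp add: prefixes_def tails_def)
    next
      case a: 2
      have "act (F2 # s) = act [F2, F0, F0]" using a by (intro nf_eq_imp_act_eq) auto
      then have "act ([F2] @ [F0, F0]) = act ([F2] @ w)"
        using left[of "[F2]"] 1 by simp
      then show False
        using act_prefix_tails_core[of "[F2]" "[F0, F0]" n w] w by (simp add: prefixes_def tails_def)
    qed
  next
    case 2
    have "hd s \<noteq> F2"
      using act_F2_neq[of "F0 # w" "tl s"] eq ne 2 by (cases s) auto
    moreover have "hd s = F2 \<or> s \<in> (@) [F0] ` tails \<or> s \<in> {[F1], [F1, F1]}"
      using small_words_cases(2)[OF s] .
    ultimately have "s \<in> {[F1], [F1, F1]}"
      using tail 2 by blast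
    moreover have "act (F2 # s) = act [F2, F0, F0]"
      using left[of "[F2]"] 2 act_20_core[OF w] by simp
    ultimately show False using 200 by blast
  next
    case 3
    have "power_out A1 X0 s \<noteq> X1"
      using act_F2_neq[of s w] eq 3 by auto
    moreover have "power_out A1 X0 s = X1 \<or> s \<in> (@) [F2] ` tails \<or> s = [F2, F2]"
      using small_words_cases(3)[OF s] .
    ultimately have "s = [F2, F2]"
      using tail 3 by blast
    \<comment> \<open>A factor \<open>F0\<close> completes the block \<open>F0 F2\<close> on both
      sides.\<close>
    then have "act (block True @ [F2]) = act (block True @ w)"
      using left[of "[F0]"] 3 by simp
    then have "collide (block True @ [F2]) (block True @ w)"
      using act_eq_imp_collide[of "[]"] by (simp add: prefixes_def)
    then show False using not_collide_F2_block core_block[OF w] by metis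
  qed
qed

lemma act_inj_normal_form:
  assumes "normal_form m v" "normal_form n w" "act v = act w"
  shows "v = w"
  using assms(1)
proof (cases rule: normal_form_cases)
  case v: small
  from assms(2) show ?thesis
  proof (cases rule: normal_form_cases)
    case small
    then show ?thesis using v assms(3) inj_onD[OF act_inj_small_words] by blast
  next
    case core
    then show ?thesis using v assms(3) act_small_core_neq by blast
  qed
next
  case v: core
  from assms(2) show ?thesis
  proof (cases rule: normal_form_cases)
    case small
    then show ?thesis using v assms(3) act_small_core_neq by metis
  next
    case core
    then show ?thesis using v assms(3) act_core_inj by blast
  qed
qed

lemma act_eq_imp_nf_eq: "u \<noteq> [] \<Longrightarrow> v \<noteq> [] \<Longrightarrow> act u = act v \<Longrightarrow> nf u = nf v"
  by (rule act_inj_normal_form[OF normal_form_nf normal_form_nf]) (simp_all add: act_nf)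

lemma cong_iff_act_eq: "u \<noteq> [] \<Longrightarrow> v \<noteq> [] \<Longrightarrow> u \<approx> v \<longleftrightarrow> act u = act v"
  using cong_imp_act_eq[of u v] act_eq_imp_nf_eq[of u v] nf_eq_imp_cong[of u v] by argo

section \<open>The presentation\<close>

lemma equiv_cong: "equiv free_semigroup (congruence_gen A1_relations)"
proof (rule equivI)
  show "congruence_gen A1_relations \<subseteq> free_semigroup \<times> free_semigroup"
    using cong_nonempty by (auto simp: free_semigroup_def)
  show "refl_on free_semigroup (congruence_gen A1_relations)"
    by (auto intro!: refl_onI congruence_gen.refl)
  show "sym (congruence_gen A1_relations)"
    by (rule symI) (rule congruence_gen.sym)
  show "Relation.trans (congruence_gen A1_relations)"
    by (rule transI) (rule congruence_gen.trans)
qed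

lemma automaton_semigroup_A1: "automaton_semigroup A1 = act ` free_semigroup"
proof
  have "f \<in> act ` free_semigroup" if "f \<in> automaton_semigroup A1" for f
    using that
  proof (induction rule: automaton_semigroup.induct)
    case (gen q)
    have "transf A1 q = act [q]" by (simp add: act_state_Cons)
    then show ?case by (auto simp: free_semigroup_def)
  next
    case (comp f g)
    then obtain u v where "f = act u" "g = act v" "u \<noteq> []" "v \<noteq> []"
      by (auto simp: free_semigroup_def)
    then have "f \<circ> g = act (u @ v)" "u @ v \<in> free_semigroup"
      by (simp_all add: act_append free_semigroup_def)
    then show ?case by blast
  qed
  then show "automaton_semigroup A1 \<subseteq> act ` free_semigroup" by blast
  have "act w \<in> automaton_semigroup A1" if "w \<noteq> []" for w
    using that
  proof (induction w rule: list_nonempty_induct)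
    case (single q)
    then show ?case using automaton_semigroup.gen[of q A1] by (simp add: act_state_Cons)
  next
    case (cons q w)
    then show ?case
      unfolding act_state_Cons by (intro automaton_semigroup.intros) simp_all
  qed
  then show "act ` free_semigroup \<subseteq> automaton_semigroup A1"
    by (auto simp: free_semigroup_def)
qed

lemma presented_by_A1: "presented_by (automaton_semigroup A1) (\<circ>) (transf A1) A1_relations"
proof -
  let ?C = "congruence_gen A1_relations"
  \<comment> \<open>The choice of a representative is harmless by
    \<open>cong_imp_act_eq\<close>.\<close>
  define \<phi> where "\<phi> X = act (SOME w. w \<in> X)" for X
  have \<phi>: "\<phi> (?C `` {w}) = act w" if "w \<noteq> []" for w
  proof -
    have "w \<in> ?C `` {w}" using that cong_refl by simp
    then have "(SOME v. v \<in> ?C `` {w}) \<in> ?C `` {w}" by (rule someI)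
    then show ?thesis using cong_imp_act_eq unfolding \<phi>_def by auto
  qed
  have "inj_on \<phi> (free_semigroup // ?C)"
  proof (rule inj_onI)
    fix X Y
    assume "X \<in> free_semigroup // ?C" "Y \<in> free_semigroup // ?C" and eq: "\<phi> X = \<phi> Y"
    then obtain u v where uv: "X = ?C `` {u}" "Y = ?C `` {v}" "u \<noteq> []" "v \<noteq> []"
      by (auto simp: quotient_def free_semigroup_def)
    then have "u \<approx> v" using eq \<phi> cong_iff_act_eq by simp
    then show "X = Y" using uv equiv_class_eq[OF equiv_cong] by blast
  qed
  moreover have "\<phi> ` (free_semigroup // ?C) = automaton_semigroup A1"
  proof -
    have "\<phi> ` (free_semigroup // ?C) = (\<lambda>w. \<phi> (?C `` {w})) ` free_semigroup"
      by (auto simp: quotient_def)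
    also have "\<dots> = act ` free_semigroup"
      by (rule image_cong) (simp_all add: \<phi> free_semigroup_def)
    finally show ?thesis by (simp add: automaton_semigroup_A1)
  qed
  ultimately have "bij_betw \<phi> (free_semigroup // ?C) (automaton_semigroup A1)"
    by (simp add: bij_betw_def)
  moreover have "A1_relations \<subseteq> free_semigroup \<times> free_semigroup"
    using A1_relations_nonempty by (auto simp: free_semigroup_def)
  moreover have "\<forall>u\<in>free_semigroup. \<forall>v\<in>free_semigroup.
      \<phi> (?C `` {u @ v}) = \<phi> (?C `` {u}) \<circ> \<phi> (?C `` {v})"
    by (simp add: \<phi> act_append free_semigroup_def)
  moreover have "\<forall>q. \<phi> (?C `` {[q]}) = transf A1 q"
    by (simp add: \<phi> act_state_Cons)
  ultimately show ?thesis unfolding presented_by_def by blast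
qed

section \<open>Counting normal forms\<close>

lemma finite_UNIV_state: "finite (UNIV :: state set)"
proof (rule finite_subset)
  show "UNIV \<subseteq> {F0, F1, F2}" using state.exhaust by auto
qed simp

lemma mealy_automaton_A1: "mealy_automaton A1"
  by (simp add: mealy_automaton_def finite_UNIV_state)

lemma growth_A1:
  assumes "0 < n"
  shows "growth A1 n = card {w. normal_form n w}"
proof -
  have "growth A1 n = card (act ` {w. length w = n})"
    by (simp add: growth_eq_card[OF mealy_automaton_A1] act_def[abs_def])
  also have "act ` {w. length w = n} = act ` nf ` {w. length w = n}"
    by (simp add: image_image act_nf)
  also have "card \<dots> = card (nf ` {w. length w = n})"
    using nf_image[OF assms] act_inj_normal_form by (intro card_image inj_onI) auto
  finally show ?thesis by (simp add: nf_image[OF assms])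
qed

lemma core_2: "{w. core 2 w} = {[F0, F2], [F1, F0]}"
proof -
  have "w \<in> {[F0, F2], [F1, F0]}" if "core 2 w" for w
    using that by cases (auto dest: core_ge_2)
  moreover have "core 2 [F0, F2]" "core 2 [F1, F0]"
    using core_short[of "[F0, F2]"] core_short[of "[F1, F0]"] by (simp_all add: numeral_2_eq_2)
  ultimately show ?thesis by blast
qed

lemma core_3: "{w. core 3 w} =
  {[F0, F2, F0], [F0, F2, F1], [F0, F2, F2], [F1, F0, F0], [F1, F0, F1], [F1, F0, F2]}" (is "_ = ?S")
proof -
  have "w \<in> ?S" if "core 3 w" for w
    using that by cases (auto dest: core_ge_2)
  moreover have "core 3 w" if "w \<in> ?S" for w
    using that core_short[of w] core_102[of 3] by (auto simp: numeral_eq_Suc)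
  ultimately show ?thesis by blast
qed

lemma core_4: "{w. core 4 w} =
  {[F0, F2, F1, F1], [F1, F0, F1, F1], [F1, F0, F2], [F1, F0, F0, F0],
   [F0, F2, F0, F2], [F0, F2, F1, F0], [F1, F0, F0, F2], [F1, F0, F1, F0]}" (is "_ = ?S")
proof -
  have 2: "core 2 w \<longleftrightarrow> w = [F0, F2] \<or> w = [F1, F0]" for w
    using core_2 by auto
  have "core 4 [F0, F2, F1, F1]" "core 4 [F1, F0, F1, F1]"
    using core_short[of "[F0, F2, F1, F1]"] core_short[of "[F1, F0, F1, F1]"]
    by (simp_all add: numeral_eq_Suc)
  moreover have "w \<in> ?S" if "core 4 w" for w
    using that by cases (auto simp: 2)
  moreover have "core 4 w" if "w \<in> ?S" for w
    using that calculation(1,2) core_102[of 4] core_1000[of 4] core_True[of 2 "tl (tl w)"] core_False[of 2 "tl (tl w)"]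
    by (auto simp: 2)
  ultimately show ?thesis by blast
qed

text \<open>The tail rules reach only \<open>n\<close> up to 4, so they contribute nothing at
  \<open>n + 2\<close>.\<close>

lemma core_rec:
  assumes "3 \<le> n"
  shows "{w. core (n + 2) w} = {[F1, F0, F2], [F1, F0, F0, F0]} \<union>
    (\<lambda>w. F0 # F2 # w) ` {w. core n w} \<union> (\<lambda>w. F1 # F0 # w) ` ({w. core n w} - {[F1, F0, F2]})"
    (is "_ = ?S")
proof -
  have "w \<in> ?S" if "core (n + 2) w" for w
    using that assms by cases auto
  moreover have "core (n + 2) w" if "w \<in> ?S" for w
    using that assms core_102[of "n + 2"] core_1000[of "n + 2"] core_True[of n] core_False[of n]
    by auto
  ultimately show ?thesis by blast
qed

lemma core_length_le: "core n w \<Longrightarrow> length w \<le> n"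
  by (induction rule: core.induct) auto

lemma finite_core: "finite {w. core n w}"
proof (rule finite_subset)
  show "{w. core n w} \<subseteq> {w. set w \<subseteq> UNIV \<and> length w \<le> n}"
    using core_length_le by auto
qed (rule finite_lists_length_le[OF finite_UNIV_state])

lemma card_core_rec:
  assumes "3 \<le> n"
  shows "card {w. core (n + 2) w} = 2 * card {w. core n w} + 1"
proof -
  let ?K = "{w. core n w}"
  let ?A = "{[F1, F0, F2], [F1, F0, F0, F0]}"
  let ?B = "(\<lambda>w. F0 # F2 # w) ` ?K" and ?D = "(\<lambda>w. F1 # F0 # w) ` (?K - {[F1, F0, F2]})"
  have 102: "[F1, F0, F2] \<in> ?K" using assms core_102 by simp
  \<comment> \<open>Otherwise \<open>F1 F0\<close> times one of these words would be a left zero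
    already counted in \<open>?A\<close>.\<close>
  have notin: "\<not> core n [F2]" "\<not> core n [F0, F0]"
    using core_block[of n "[F2]"] core_block[of n "[F0, F0]"]
    by (auto simp: block_def split: if_splits)
  have disj: "?A \<inter> ?B = {}" "(?A \<union> ?B) \<inter> ?D = {}" using notin by auto
  have "card {w. core (n + 2) w} = card (?A \<union> ?B) + card ?D"
    unfolding core_rec[OF assms] using finite_core disj by (intro card_Un_disjoint) auto
  also have "card (?A \<union> ?B) = card ?A + card ?B"
    using finite_core disj by (intro card_Un_disjoint) auto
  also have "card ?B = card ?K" by (rule card_image) (simp add: inj_on_def)
  also have "card ?D = card (?K - {[F1, F0, F2]})" by (rule card_image) (simp add: inj_on_def)
  also have "\<dots> = card ?K - 1" using 102 finite_core by simp
  finally have "card {w. core (n + 2) w} = 2 + card ?K + (card ?K - 1)" by simp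
  moreover have "card ?K \<noteq> 0" using 102 finite_core by auto
  ultimately show ?thesis by linarith
qed

text \<open>Adding one turns the recurrence into plain doubling. Its step is 2, so even and odd
  \<open>n\<close> start independently, from 8 and 6 words; this is where the two expressions come
  from.\<close>

lemma card_core_even: "card {w. core (2 * m + 4) w} + 1 = 9 * 2 ^ m"
proof (induction m)
  case (Suc m)
  have "card {w. core (2 * Suc m + 4) w} = 2 * card {w. core (2 * m + 4) w} + 1"
    using card_core_rec[of "2 * m + 4"] by (simp add: ac_simps)
  then show ?case using Suc by simp
qed (simp add: core_4)

lemma card_core_odd: "card {w. core (2 * m + 3) w} + 1 = 7 * 2 ^ m"
proof (induction m)
  case (Suc m)
  have "card {w. core (2 * Suc m + 3) w} = 2 * card {w. core (2 * m + 3) w} + 1"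
    using card_core_rec[of "2 * m + 3"] by (simp add: ac_simps)
  then show ?case using Suc by simp
qed (simp add: core_3)

text \<open>No short word has four letters. There remain core words, core words of level
  \<open>n\<close> behind \<open>F0\<close> or \<open>F2\<close>, and the two left zeros.\<close>

lemma card_normal_form:
  assumes "3 \<le> n"
  shows "card {w. normal_form (Suc n) w} = card {w. core (Suc n) w} + 2 * card {w. core n w} + 2"
proof -
  let ?K = "{w. core n w}" and ?L = "{w. core (Suc n) w}"
  let ?A = "{[F0, F0, F0], [F2, F0, F0]}" and ?B = "(#) F0 ` ?K" and ?D = "(#) F2 ` ?K"
  have shape: "(\<exists>u. w = F0 # F2 # u) \<or> (\<exists>u. w = F1 # F0 # u)" if "core m w" for m w
    using core_block[OF that] by (auto simp: block_def split: if_splits)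
  have "w \<in> ?A \<union> ?L \<union> ?B \<union> ?D" if "normal_form (Suc n) w" for w
    using that assms by cases (auto simp: short_words_def)
  moreover have "normal_form (Suc n) w" if "w \<in> ?A \<union> ?L \<union> ?B \<union> ?D" for w
    using that assms normal_form_zero[of "Suc n"] normal_form_core[of "Suc n"]
      normal_form_F0[of n] normal_form_F2[of n] by auto
  ultimately have eq: "{w. normal_form (Suc n) w} = ?A \<union> ?L \<union> ?B \<union> ?D" by blast
  have disj: "?A \<inter> ?L = {}" "(?A \<union> ?L) \<inter> ?B = {}" "(?A \<union> ?L \<union> ?B) \<inter> ?D = {}"
    by (auto dest!: shape)
  have "card {w. normal_form (Suc n) w} = card (?A \<union> ?L \<union> ?B) + card ?D"
    unfolding eq using finite_core disj by (intro card_Un_disjoint) auto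
  also have "card (?A \<union> ?L \<union> ?B) = card (?A \<union> ?L) + card ?B"
    using finite_core disj by (intro card_Un_disjoint) auto
  also have "card (?A \<union> ?L) = card ?A + card ?L"
    using finite_core disj by (intro card_Un_disjoint) auto
  also have "card ?B = card ?K" by (rule card_image) simp
  also have "card ?D = card ?K" by (rule card_image) simp
  finally show ?thesis by simp
qed

lemma growth_A1_Suc:
  "3 \<le> n \<Longrightarrow> growth A1 (Suc n) = card {w. core (Suc n) w} + 2 * card {w. core n w} + 2"
  by (simp add: growth_A1 card_normal_form)

lemma growth_A1_even: "growth A1 (2 * m + 4) + 1 = 23 * 2 ^ m"
proof -
  have "2 * m + 4 = Suc (2 * m + 3)" by simp
  then have "growth A1 (2 * m + 4) =
      card {w. core (2 * m + 4) w} + 2 * card {w. core (2 * m + 3) w} + 2"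
    using growth_A1_Suc[of "2 * m + 3"] by (metis le_add2)
  then show ?thesis using card_core_even[of m] card_core_odd[of m] by linarith
qed

lemma growth_A1_odd: "growth A1 (2 * m + 5) + 1 = 32 * 2 ^ m"
proof -
  have "3 \<le> 2 * m + 4" "Suc (2 * m + 4) = 2 * m + 5" "2 * m + 5 = 2 * Suc m + 3" by simp_all
  then have "growth A1 (2 * m + 5) =
      card {w. core (2 * Suc m + 3) w} + 2 * card {w. core (2 * m + 4) w} + 2"
    using growth_A1_Suc[of "2 * m + 4"] by metis
  then show ?thesis using card_core_even[of m] card_core_odd[of "Suc m"] by simp
qed

lemma normal_form_shortI: "w \<in> short_words \<Longrightarrow> length w = n \<Longrightarrow> normal_form n w"
  using normal_form_short by blast

lemma normal_form_1: "{w. normal_form 1 w} = {[F0], [F1], [F2]}" (is "_ = ?S")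
proof -
  have "w \<in> ?S" if "normal_form 1 w" for w
    using that by cases (auto simp: short_words_def dest: core_ge_2)
  moreover have "\<forall>w\<in>?S. normal_form 1 w"
    by (simp add: normal_form_shortI short_words_def)
  ultimately show ?thesis by blast
qed

lemma normal_form_2: "{w. normal_form 2 w} =
  {[F0, F0], [F0, F1], [F0, F2], [F1, F0], [F1, F1], [F2, F0], [F2, F1], [F2, F2]}" (is "_ = ?S")
proof -
  have core: "core 2 w \<longleftrightarrow> w = [F0, F2] \<or> w = [F1, F0]" for w
    using core_2 by auto
  have "w \<in> ?S" if "normal_form 2 w" for w
    using that
  proof cases
    case normal_form_short
    then show ?thesis unfolding short_words_def by (elim insertE emptyE) simp_all
  next
    case normal_form_core
    then show ?thesis by (auto simp: core)
  qed (auto dest: core_ge_2)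
  then have "{w. normal_form 2 w} \<subseteq> ?S" by (simp only: subset_iff mem_Collect_eq) simp
  moreover have "?S \<subseteq> {w. normal_form 2 w}"
    by (simp add: normal_form_shortI short_words_def normal_form_core core)
  ultimately show ?thesis by (rule equalityI)
qed

lemma normal_form_3: "{w. normal_form 3 w} =
  {[F0, F1, F1], [F2, F1, F1], [F0, F0, F0], [F2, F0, F0]} \<union> {w. core 3 w} \<union>
  {[F0, F0, F2], [F0, F1, F0], [F2, F0, F2], [F2, F1, F0]}" (is "_ = ?S")
proof -
  have core: "core 2 w \<longleftrightarrow> w = [F0, F2] \<or> w = [F1, F0]" for w
    using core_2 by auto
  have "w \<in> ?S" if "normal_form 3 w" for w
    using that
  proof cases
    case normal_form_short
    then show ?thesis unfolding short_words_def by (elim insertE emptyE) simp_all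
  next
    case (normal_form_F0 n v)
    then have "core 2 v" by (simp add: numeral_3_eq_3 numeral_2_eq_2)
    then show ?thesis using normal_form_F0 by (auto simp: core)
  next
    case (normal_form_F2 n v)
    then have "core 2 v" by (simp add: numeral_3_eq_3 numeral_2_eq_2)
    then show ?thesis using normal_form_F2 by (auto simp: core)
  qed auto
  moreover have "normal_form 3 w" if "w \<in> ?S" for w
  proof -
    have "\<forall>w\<in>{[F0, F0, F2], [F0, F1, F0], [F2, F0, F2], [F2, F1, F0]}. normal_form (Suc 2) w"
      by (simp add: normal_form_F0 normal_form_F2 core del: Suc_numeral)
    moreover have "\<forall>w\<in>{[F0, F1, F1], [F2, F1, F1], [F0, F0, F0], [F2, F0, F0]}. normal_form 3 w"
      by (simp add: normal_form_shortI short_words_def normal_form_zero)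
    moreover have "Suc 2 = 3" by simp
    ultimately show ?thesis using that normal_form_core[of 3 w] by auto
  qed
  ultimately show ?thesis by blast
qed

theorem theorem3p1:
  shows "presented_by (automaton_semigroup A1) (\<circ>) (transf A1) A1_relations \<and>
    composite_for (growth A1) 2 \<and>
    (\<forall>n\<ge>2. growth A1 (2 * n) = 23 * 2 ^ (n - 2) - 1 \<and>
            growth A1 (2 * n + 1) = 32 * 2 ^ (n - 2) - 1) \<and>
    growth A1 1 = 3 \<and> growth A1 2 = 8 \<and> growth A1 3 = 14"
proof -
  have growth: "growth A1 (2 * n) + 1 = 23 * 2 ^ (n - 2) \<and> growth A1 (2 * n + 1) + 1 = 32 * 2 ^ (n - 2)"
    if "2 \<le> n" for n
  proof -
    from that obtain m where "n = m + 2" using le_Suc_ex by (metis add.commute)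
    then have "2 * n = 2 * m + 4" "2 * n + 1 = 2 * m + 5" "n - 2 = m" by simp_all
    then show ?thesis using growth_A1_even[of m] growth_A1_odd[of m] by metis
  qed
  \<comment> \<open>The two values, increased by one, are 23 and 32 times the same power of
    two.\<close>
  have "{2..} \<subseteq> {n. growth A1 (2 * n + 0) \<noteq> growth A1 (2 * n + 1)}"
  proof
    fix n :: nat assume "n \<in> {2..}"
    then show "n \<in> {n. growth A1 (2 * n + 0) \<noteq> growth A1 (2 * n + 1)}"
      using growth[of n] by auto
  qed
  then have "infinite {n. growth A1 (2 * n + 0) \<noteq> growth A1 (2 * n + 1)}"
    using infinite_Ici infinite_super by blast
  then have "composite_for (growth A1) 2"
    unfolding composite_for_def by (intro conjI exI[of _ 0] exI[of _ 1]) auto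
  moreover have "growth A1 (2 * n) = 23 * 2 ^ (n - 2) - 1 \<and> growth A1 (2 * n + 1) = 32 * 2 ^ (n - 2) - 1"
    if "2 \<le> n" for n
    using growth[OF that] by linarith
  moreover have "growth A1 1 = 3" "growth A1 2 = 8" "growth A1 3 = 14"
    by (simp_all add: growth_A1 normal_form_1[simplified] normal_form_2 normal_form_3 core_3)
  ultimately show ?thesis using presented_by_A1 by blast
qed

end
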